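(* Let $T$ be a $\mathrm{Gray}$-monad on a $\mathrm{Gray}$-category $\mathcal{K}$. Given the data $(X,x,m,i,\pi,\lambda,\rho)$ of a pseudo $T$-algebra, the pentagon-like axiom (LAA1) and the triangle-like axiom (LAA4) imply the other two axioms (LAA2) and (LAA3); i.e. these two axioms are redundant.
   Context: $\mathrm{Gray}$ is the symmetric monoidal closed category of small 2-categories and strict functors with the (pseudo) Gray product $\otimes$, which is generated by 1-cells $(f,1),(1,g)$, 2-cells $(\alpha,1),(1,\beta)$ and invertible interchange cells $\Sigma_{f,g}\colon(f,1)*(1,g)\Rightarrow(1,g)*(f,1)$. $*$ is horizontal and $\diamond$ vertical composition, read right to left. $\mathcal{K}$ has composition laws $M_{\mathcal{K}}\colon\mathcal{K}(B,C)\otimes\mathcal{K}(A,B)\to\mathcal{K}(A,C)$; juxtaposition denotes their application: $gf=M(g,f)$, $\alpha f=M(\alpha,1_f)$, $g\beta=M(1_g,\beta)$. For 1-cells $\alpha\colon g\to g'$ of $\mathcal{K}(B,C)$ and $\beta\colon f\to f'$ of $\mathcal{K}(A,B)$, $\Sigma_{\alpha,\beta}$ also denotes $M(\Sigma_{\alpha,\beta})\colon(\alpha f')*(g\beta)\Rightarrow(g'\beta)*(\alpha f)$. An unadorned $1$ is the identity 2-cell on the remaining horizontal factors. $T$ has multiplication $\mu$ and unit $\eta$. The data of a pseudo $T$-algebra are: an object $X$ of $\mathcal{K}$; an object $x$ of $\mathcal{K}(TX,X)$; adjoint equivalences $m\colon x\,Tx\to x\mu_X$ in $\mathcal{K}(T^2X,X)$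 and $i\colon1_X\to x\eta_X$ in $\mathcal{K}(X,X)$; and invertible 2-cells $\pi\colon(m\mu_{TX})*(m\,T^2x)\Rightarrow(m\,T\mu_X)*(x\,Tm)$ in $\mathcal{K}(T^3X,X)$, $\lambda\colon(m\eta_{TX})*(ix)\Rightarrow1_x$ in $\mathcal{K}(TX,X)$, $\rho\colon(m\,T\eta_X)*(x\,Ti)\Rightarrow1_x$ in $\mathcal{K}(TX,X)$ (domains and codomains match by naturality of $\mu,\eta$ and the monad axioms). The four axioms are: (LAA1), in $\mathcal{K}(T^4X,X)$: $((\pi\,T^2\mu_X)*1_{x\,Tx\,T^2m})\diamond(1_{m\,T\mu_X\,\mu_{T^2X}}*\Sigma^{-1}_{m,T^2m})\diamond((\pi\mu_{T^2X})*1_{m\,T^2x\,T^3x})=(1_{m\,T\mu_X\,T\mu_{TX}}*(x\,T\pi))\diamond((\pi\,T\mu_{TX})*1_{x\,Tm\,T^3x})\diamond(1_{m\mu_{TX}\mu_{T^2X}}*(\pi\,T^3x))$. (LAA2), in $\mathcal{K}(T^2X,X)$: $((\rho\mu_X)*1_m)\diamond(1_{m\,\mu_{TX}T^2\eta_X}*\Sigma_{m,T^2i})=(1_m*(x\,T\rho))\diamond((\pi\,T^2\eta_X)*1_{x\,Tx\,T^2i})$. (LAA3), in $\mathcal{K}(T^2X,X)$: $1_m*(\lambda\,Tx)=((\lambda\mu_X)*1_m)\diamond(1_{m\,\eta_{TX}\mu_X}*\Sigma^{-1}_{i,m})\diamond((\pi\eta_{T^2X})*1_{i\,x\,Tx})$.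 (LAA4), in $\mathcal{K}(T^2X,X)$: $(1_m*(x\,T\lambda))\diamond((\pi\,T\eta_{TX})*1_{x\,Ti\,Tx})=1_m*(\rho\,Tx)$. *)

theory Defs
  imports Main
begin

section \<open>Strict 2-categories\<close>

text \<open>The types \<open>'a\<close>, \<open>'b\<close>, \<open>'c\<close> are the sets of 0-, 1- and 2-cells. Compositions are total
  functions, specified only on composable pairs, and are read right to left.
  \<open>\<star>\<close> is horizontal composition of 1-cells, \<open>\<star>\<^sub>2\<close> horizontal composition of 2-cells,
  and \<open>\<diamondop>\<close> vertical composition.\<close>

record ('a, 'b, 'c) two_cat =
  dom1 :: "'b \<Rightarrow> 'a" ("dom1\<index>")
  cod1 :: "'b \<Rightarrow> 'a" ("cod1\<index>")
  id1 :: "'a \<Rightarrow> 'b" ("id1\<index>")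
  comp1 :: "'b \<Rightarrow> 'b \<Rightarrow> 'b" (infixl "\<star>\<index>" 70)
  dom2 :: "'c \<Rightarrow> 'b" ("dom2\<index>")
  cod2 :: "'c \<Rightarrow> 'b" ("cod2\<index>")
  id2 :: "'b \<Rightarrow> 'c" ("id2\<index>")
  vcomp :: "'c \<Rightarrow> 'c \<Rightarrow> 'c" (infixl "\<diamondop>\<index>" 65)
  hcomp :: "'c \<Rightarrow> 'c \<Rightarrow> 'c" (infixl "\<star>\<^sub>2\<index>" 70)

locale two_category =
  fixes C :: "('a, 'b, 'c, 'z) two_cat_scheme" (structure)
  assumes id1_bd: "dom1 (id1 a) = a" "cod1 (id1 a) = a"
    and comp1_bd:
      "dom1 g = cod1 f \<Longrightarrow> dom1 (g \<star> f) = dom1 f"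
      "dom1 g = cod1 f \<Longrightarrow> cod1 (g \<star> f) = cod1 g"
    and comp1_id: "f \<star> id1 (dom1 f) = f" "id1 (cod1 f) \<star> f = f"
    and comp1_assoc:
      "dom1 h = cod1 g \<Longrightarrow> dom1 g = cod1 f \<Longrightarrow> (h \<star> g) \<star> f = h \<star> (g \<star> f)"
    and globular: "dom1 (cod2 \<theta>) = dom1 (dom2 \<theta>)" "cod1 (cod2 \<theta>) = cod1 (dom2 \<theta>)"
    and id2_bd: "dom2 (id2 f) = f" "cod2 (id2 f) = f"
    and vcomp_bd:
      "dom2 \<psi> = cod2 \<phi> \<Longrightarrow> dom2 (\<psi> \<diamondop> \<phi>) = dom2 \<phi>"
      "dom2 \<psi> = cod2 \<phi> \<Longrightarrow> cod2 (\<psi> \<diamondop> \<phi>) = cod2 \<psi>"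
    and vcomp_id: "\<phi> \<diamondop> id2 (dom2 \<phi>) = \<phi>" "id2 (cod2 \<phi>) \<diamondop> \<phi> = \<phi>"
    and vcomp_assoc:
      "dom2 \<chi> = cod2 \<psi> \<Longrightarrow> dom2 \<psi> = cod2 \<phi> \<Longrightarrow> (\<chi> \<diamondop> \<psi>) \<diamondop> \<phi> = \<chi> \<diamondop> (\<psi> \<diamondop> \<phi>)"
    and hcomp_bd:
      "dom1 (dom2 \<psi>) = cod1 (dom2 \<phi>) \<Longrightarrow> dom2 (\<psi> \<star>\<^sub>2 \<phi>) = dom2 \<psi> \<star> dom2 \<phi>"
      "dom1 (dom2 \<psi>) = cod1 (dom2 \<phi>) \<Longrightarrow> cod2 (\<psi> \<star>\<^sub>2 \<phi>) = cod2 \<psi> \<star> cod2 \<phi>"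
    and hcomp_id:
      "\<phi> \<star>\<^sub>2 id2 (id1 (dom1 (dom2 \<phi>))) = \<phi>"
      "id2 (id1 (cod1 (dom2 \<phi>))) \<star>\<^sub>2 \<phi> = \<phi>"
    and hcomp_assoc:
      "dom1 (dom2 \<chi>) = cod1 (dom2 \<psi>) \<Longrightarrow> dom1 (dom2 \<psi>) = cod1 (dom2 \<phi>) \<Longrightarrow>
         (\<chi> \<star>\<^sub>2 \<psi>) \<star>\<^sub>2 \<phi> = \<chi> \<star>\<^sub>2 (\<psi> \<star>\<^sub>2 \<phi>)"
    and hcomp_id2: "dom1 g = cod1 f \<Longrightarrow> id2 g \<star>\<^sub>2 id2 f = id2 (g \<star> f)"
    and interchange:
      "dom2 \<psi>' = cod2 \<psi> \<Longrightarrow> dom2 \<phi>' = cod2 \<phi> \<Longrightarrow> dom1 (dom2 \<psi>) = cod1 (dom2 \<phi>) \<Longrightarrow>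
         (\<psi>' \<diamondop> \<psi>) \<star>\<^sub>2 (\<phi>' \<diamondop> \<phi>) = (\<psi>' \<star>\<^sub>2 \<phi>') \<diamondop> (\<psi> \<star>\<^sub>2 \<phi>)"

context
  fixes C :: "('a, 'b, 'c, 'z) two_cat_scheme" (structure)
begin

definition inverse2 :: "'c \<Rightarrow> 'c \<Rightarrow> bool" where
  "inverse2 \<theta> \<phi> \<longleftrightarrow> dom2 \<phi> = cod2 \<theta> \<and> cod2 \<phi> = dom2 \<theta> \<and>
     \<phi> \<diamondop> \<theta> = id2 (dom2 \<theta>) \<and> \<theta> \<diamondop> \<phi> = id2 (cod2 \<theta>)"

definition invertible2 :: "'c \<Rightarrow> bool" where
  "invertible2 \<theta> \<longleftrightarrow> (\<exists>\<phi>. inverse2 \<theta> \<phi>)"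

definition vinv :: "'c \<Rightarrow> 'c" where
  "vinv \<theta> = (THE \<phi>. inverse2 \<theta> \<phi>)"

definition adjoint_equivalence :: "'b \<Rightarrow> 'b \<Rightarrow> 'c \<Rightarrow> 'c \<Rightarrow> bool" where
  "adjoint_equivalence f g u e \<longleftrightarrow>
     dom1 g = cod1 f \<and> cod1 g = dom1 f \<and>
     dom2 u = id1 (dom1 f) \<and> cod2 u = g \<star> f \<and> invertible2 u \<and>
     dom2 e = f \<star> g \<and> cod2 e = id1 (cod1 f) \<and> invertible2 e \<and>
     (e \<star>\<^sub>2 id2 f) \<diamondop> (id2 f \<star>\<^sub>2 u) = id2 f \<and>
     (id2 g \<star>\<^sub>2 e) \<diamondop> (u \<star>\<^sub>2 id2 g) = id2 g"

end

text \<open>Strict functors to \<open>D\<close> from the full sub-2-category of \<open>C\<close> on a set \<open>S\<close> of 0-cells. It is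
  only used for \<open>S\<close> closed under the existence of a 1-cell in either direction, so that
  it suffices to require one end of a cell to lie in \<open>S\<close>.\<close>

locale strict_functor_on =
  fixes C :: "('a, 'b, 'c, 'z) two_cat_scheme"
    and S :: "'a set"
    and D :: "('d, 'e, 'f, 'y) two_cat_scheme"
    and F0 :: "'a \<Rightarrow> 'd" and F1 :: "'b \<Rightarrow> 'e" and F2 :: "'c \<Rightarrow> 'f"
  assumes bd1:
      "dom1\<^bsub>C\<^esub> f \<in> S \<Longrightarrow> dom1\<^bsub>D\<^esub> (F1 f) = F0 (dom1\<^bsub>C\<^esub> f)"
      "dom1\<^bsub>C\<^esub> f \<in> S \<Longrightarrow> cod1\<^bsub>D\<^esub> (F1 f) = F0 (cod1\<^bsub>C\<^esub> f)"
    and pres_id1: "a \<in> S \<Longrightarrow> F1 (id1\<^bsub>C\<^esub> a) = id1\<^bsub>D\<^esub> (F0 a)"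
    and pres_comp1:
      "dom1\<^bsub>C\<^esub> f \<in> S \<Longrightarrow> dom1\<^bsub>C\<^esub> g = cod1\<^bsub>C\<^esub> f \<Longrightarrow> F1 (g \<star>\<^bsub>C\<^esub> f) = F1 g \<star>\<^bsub>D\<^esub> F1 f"
    and bd2:
      "dom1\<^bsub>C\<^esub> (dom2\<^bsub>C\<^esub> \<theta>) \<in> S \<Longrightarrow> dom2\<^bsub>D\<^esub> (F2 \<theta>) = F1 (dom2\<^bsub>C\<^esub> \<theta>)"
      "dom1\<^bsub>C\<^esub> (dom2\<^bsub>C\<^esub> \<theta>) \<in> S \<Longrightarrow> cod2\<^bsub>D\<^esub> (F2 \<theta>) = F1 (cod2\<^bsub>C\<^esub> \<theta>)"
    and pres_id2: "dom1\<^bsub>C\<^esub> f \<in> S \<Longrightarrow> F2 (id2\<^bsub>C\<^esub> f) = id2\<^bsub>D\<^esub> (F1 f)"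
    and pres_vcomp:
      "dom1\<^bsub>C\<^esub> (dom2\<^bsub>C\<^esub> \<phi>) \<in> S \<Longrightarrow> dom2\<^bsub>C\<^esub> \<psi> = cod2\<^bsub>C\<^esub> \<phi> \<Longrightarrow>
         F2 (\<psi> \<diamondop>\<^bsub>C\<^esub> \<phi>) = F2 \<psi> \<diamondop>\<^bsub>D\<^esub> F2 \<phi>"
    and pres_hcomp:
      "dom1\<^bsub>C\<^esub> (dom2\<^bsub>C\<^esub> \<phi>) \<in> S \<Longrightarrow> dom1\<^bsub>C\<^esub> (dom2\<^bsub>C\<^esub> \<psi>) = cod1\<^bsub>C\<^esub> (dom2\<^bsub>C\<^esub> \<phi>) \<Longrightarrow>
         F2 (\<psi> \<star>\<^sub>2\<^bsub>C\<^esub> \<phi>) = F2 \<psi> \<star>\<^sub>2\<^bsub>D\<^esub> F2 \<phi>"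


section \<open>Gray-categories\<close>

text \<open>A Gray-category \<open>K\<close> with set of objects \<open>'o\<close> is given by the disjoint union of its
  hom-2-categories: \<open>K(A,B)\<close> consists of the 0-cells \<open>f\<close> with \<open>src f = A\<close> and \<open>tgt f = B\<close>
  and of the 1- and 2-cells between such. So \<open>'a\<close>, \<open>'b\<close>, \<open>'c\<close> are the 0-, 1- and 2-cells
  of the hom-2-categories, and the fields inherited from \<open>two_cat\<close> are the operations of the
  hom-2-categories.

  The composition law \<open>M : K(B,C) \<otimes> K(A,B) \<rightarrow> K(A,C)\<close> is a strict functor out of a 2-category
  presented by generators and relations, so it is given by its values on the generators:
  \<open>g \<cdot> f = M(g,f)\<close> on 0-cells, \<open>\<alpha> \<triangleleft> f = M(\<alpha>,1\<^sub>f)\<close> and \<open>g \<triangleright> \<beta> = M(1\<^sub>g,\<beta>)\<close> on 1-cells,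
  \<open>\<phi> \<triangleleft>\<^sub>2 f\<close> and \<open>g \<triangleright>\<^sub>2 \<psi>\<close> on 2-cells, and \<open>\<Sigma>\<langle>\<alpha>, \<beta>\<rangle>\<close> on the interchange cells.\<close>

record ('o, 'a, 'b, 'c) gray_cat = "('a, 'b, 'c) two_cat" +
  src :: "'a \<Rightarrow> 'o" ("src\<index>")
  tgt :: "'a \<Rightarrow> 'o" ("tgt\<index>")
  one :: "'o \<Rightarrow> 'a" ("one\<index>")
  comp0 :: "'a \<Rightarrow> 'a \<Rightarrow> 'a" (infixl "\<cdot>\<index>" 80)
  rwhisk1 :: "'b \<Rightarrow> 'a \<Rightarrow> 'b" (infixl "\<triangleleft>\<index>" 75)
  lwhisk1 :: "'a \<Rightarrow> 'b \<Rightarrow> 'b" (infixr "\<triangleright>\<index>" 75)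
  rwhisk2 :: "'c \<Rightarrow> 'a \<Rightarrow> 'c" (infixl "\<triangleleft>\<^sub>2\<index>" 75)
  lwhisk2 :: "'a \<Rightarrow> 'c \<Rightarrow> 'c" (infixr "\<triangleright>\<^sub>2\<index>" 75)
  interch :: "'b \<Rightarrow> 'b \<Rightarrow> 'c" ("\<Sigma>\<index>\<langle>_, _\<rangle>")

text \<open>\<open>K(B,C) \<otimes> K(A,B)\<close> is presented by the following relations: the generators are strictly
  functorial in each variable separately (\<open>rwhisk_functor\<close>, \<open>lwhisk_functor\<close>), and the
  invertible interchange cells are compatible with identities and composition of 1-cells and
  natural with respect to 2-cells in each variable (\<open>interch_*\<close>). Two strict functors out of
  such a 2-category agree iff they agree on generators, whence \<open>assoc0\<close> to \<open>assoc_interch\<close>,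
  which are \<open>M(M \<otimes> 1) = M(1 \<otimes> M)a\<close> evaluated on the generators of the threefold product,
  and \<open>one0\<close> to \<open>one2\<close> for the unit laws.\<close>

locale gray_category = two_category K
  for K :: "('o, 'a, 'b, 'c, 'z) gray_cat_scheme" (structure) +
  assumes src_tgt: "src (cod1 \<alpha>) = src (dom1 \<alpha>)" "tgt (cod1 \<alpha>) = tgt (dom1 \<alpha>)"
    and one_bd: "src (one A) = A" "tgt (one A) = A"
    and comp0_bd:
      "src g = tgt f \<Longrightarrow> src (g \<cdot> f) = src f"
      "src g = tgt f \<Longrightarrow> tgt (g \<cdot> f) = tgt g"
    and rwhisk_functor:
      "strict_functor_on K {g. src g = tgt f} K (\<lambda>g. g \<cdot> f) (\<lambda>\<alpha>. \<alpha> \<triangleleft> f) (\<lambda>\<phi>. \<phi> \<triangleleft>\<^sub>2 f)"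
    and lwhisk_functor:
      "strict_functor_on K {f. src g = tgt f} K (\<lambda>f. g \<cdot> f) (\<lambda>\<beta>. g \<triangleright> \<beta>) (\<lambda>\<psi>. g \<triangleright>\<^sub>2 \<psi>)"
    and interch_bd:
      "src (dom1 \<alpha>) = tgt (dom1 \<beta>) \<Longrightarrow> dom2 \<Sigma>\<langle>\<alpha>, \<beta>\<rangle> = (\<alpha> \<triangleleft> cod1 \<beta>) \<star> (dom1 \<alpha> \<triangleright> \<beta>)"
      "src (dom1 \<alpha>) = tgt (dom1 \<beta>) \<Longrightarrow> cod2 \<Sigma>\<langle>\<alpha>, \<beta>\<rangle> = (cod1 \<alpha> \<triangleright> \<beta>) \<star> (\<alpha> \<triangleleft> dom1 \<beta>)"
    and interch_invertible:
      "src (dom1 \<alpha>) = tgt (dom1 \<beta>) \<Longrightarrow> invertible2 K \<Sigma>\<langle>\<alpha>, \<beta>\<rangle>"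
    and interch_id:
      "src g = tgt (dom1 \<beta>) \<Longrightarrow> \<Sigma>\<langle>id1 g, \<beta>\<rangle> = id2 (g \<triangleright> \<beta>)"
      "src (dom1 \<alpha>) = tgt f \<Longrightarrow> \<Sigma>\<langle>\<alpha>, id1 f\<rangle> = id2 (\<alpha> \<triangleleft> f)"
    and interch_comp:
      "src (dom1 \<alpha>) = tgt (dom1 \<beta>) \<Longrightarrow> dom1 \<alpha>' = cod1 \<alpha> \<Longrightarrow>
         \<Sigma>\<langle>\<alpha>' \<star> \<alpha>, \<beta>\<rangle> =
           (\<Sigma>\<langle>\<alpha>', \<beta>\<rangle> \<star>\<^sub>2 id2 (\<alpha> \<triangleleft> dom1 \<beta>)) \<diamondop> (id2 (\<alpha>' \<triangleleft> cod1 \<beta>) \<star>\<^sub>2 \<Sigma>\<langle>\<alpha>, \<beta>\<rangle>)"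
      "src (dom1 \<alpha>) = tgt (dom1 \<beta>) \<Longrightarrow> dom1 \<beta>' = cod1 \<beta> \<Longrightarrow>
         \<Sigma>\<langle>\<alpha>, \<beta>' \<star> \<beta>\<rangle> =
           (id2 (cod1 \<alpha> \<triangleright> \<beta>') \<star>\<^sub>2 \<Sigma>\<langle>\<alpha>, \<beta>\<rangle>) \<diamondop> (\<Sigma>\<langle>\<alpha>, \<beta>'\<rangle> \<star>\<^sub>2 id2 (dom1 \<alpha> \<triangleright> \<beta>))"
    and interch_natural:
      "src (dom1 (dom2 \<phi>)) = tgt (dom1 \<beta>) \<Longrightarrow>
         \<Sigma>\<langle>cod2 \<phi>, \<beta>\<rangle> \<diamondop> ((\<phi> \<triangleleft>\<^sub>2 cod1 \<beta>) \<star>\<^sub>2 id2 (dom1 (dom2 \<phi>) \<triangleright> \<beta>)) =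
           (id2 (cod1 (dom2 \<phi>) \<triangleright> \<beta>) \<star>\<^sub>2 (\<phi> \<triangleleft>\<^sub>2 dom1 \<beta>)) \<diamondop> \<Sigma>\<langle>dom2 \<phi>, \<beta>\<rangle>"
      "src (dom1 \<alpha>) = tgt (dom1 (dom2 \<psi>)) \<Longrightarrow>
         \<Sigma>\<langle>\<alpha>, cod2 \<psi>\<rangle> \<diamondop> (id2 (\<alpha> \<triangleleft> cod1 (dom2 \<psi>)) \<star>\<^sub>2 (dom1 \<alpha> \<triangleright>\<^sub>2 \<psi>)) =
           ((cod1 \<alpha> \<triangleright>\<^sub>2 \<psi>) \<star>\<^sub>2 id2 (\<alpha> \<triangleleft> dom1 (dom2 \<psi>))) \<diamondop> \<Sigma>\<langle>\<alpha>, dom2 \<psi>\<rangle>"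
    and assoc0: "src h = tgt g \<Longrightarrow> src g = tgt f \<Longrightarrow> (h \<cdot> g) \<cdot> f = h \<cdot> (g \<cdot> f)"
    and assoc1:
      "src (dom1 \<alpha>) = tgt g \<Longrightarrow> src g = tgt f \<Longrightarrow> (\<alpha> \<triangleleft> g) \<triangleleft> f = \<alpha> \<triangleleft> (g \<cdot> f)"
      "src h = tgt (dom1 \<beta>) \<Longrightarrow> src (dom1 \<beta>) = tgt f \<Longrightarrow> (h \<triangleright> \<beta>) \<triangleleft> f = h \<triangleright> (\<beta> \<triangleleft> f)"
      "src h = tgt g \<Longrightarrow> src g = tgt (dom1 \<gamma>) \<Longrightarrow> (h \<cdot> g) \<triangleright> \<gamma> = h \<triangleright> (g \<triangleright> \<gamma>)"
    and assoc2:
      "src (dom1 (dom2 \<phi>)) = tgt g \<Longrightarrow> src g = tgt f \<Longrightarrow> (\<phi> \<triangleleft>\<^sub>2 g) \<triangleleft>\<^sub>2 f = \<phi> \<triangleleft>\<^sub>2 (g \<cdot> f)"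
      "src h = tgt (dom1 (dom2 \<psi>)) \<Longrightarrow> src (dom1 (dom2 \<psi>)) = tgt f \<Longrightarrow>
         (h \<triangleright>\<^sub>2 \<psi>) \<triangleleft>\<^sub>2 f = h \<triangleright>\<^sub>2 (\<psi> \<triangleleft>\<^sub>2 f)"
      "src h = tgt g \<Longrightarrow> src g = tgt (dom1 (dom2 \<chi>)) \<Longrightarrow> (h \<cdot> g) \<triangleright>\<^sub>2 \<chi> = h \<triangleright>\<^sub>2 (g \<triangleright>\<^sub>2 \<chi>)"
    and assoc_interch:
      "src (dom1 \<alpha>) = tgt (dom1 \<beta>) \<Longrightarrow> src (dom1 \<beta>) = tgt f \<Longrightarrow>
         \<Sigma>\<langle>\<alpha>, \<beta>\<rangle> \<triangleleft>\<^sub>2 f = \<Sigma>\<langle>\<alpha>, \<beta> \<triangleleft> f\<rangle>"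
      "src (dom1 \<alpha>) = tgt g \<Longrightarrow> src g = tgt (dom1 \<gamma>) \<Longrightarrow>
         \<Sigma>\<langle>\<alpha> \<triangleleft> g, \<gamma>\<rangle> = \<Sigma>\<langle>\<alpha>, g \<triangleright> \<gamma>\<rangle>"
      "src h = tgt (dom1 \<beta>) \<Longrightarrow> src (dom1 \<beta>) = tgt (dom1 \<gamma>) \<Longrightarrow>
         \<Sigma>\<langle>h \<triangleright> \<beta>, \<gamma>\<rangle> = h \<triangleright>\<^sub>2 \<Sigma>\<langle>\<beta>, \<gamma>\<rangle>"
    and one0: "f \<cdot> one (src f) = f" "one (tgt f) \<cdot> f = f"
    and one1: "\<alpha> \<triangleleft> one (src (dom1 \<alpha>)) = \<alpha>" "one (tgt (dom1 \<alpha>)) \<triangleright> \<alpha> = \<alpha>"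
    and one2:
      "\<phi> \<triangleleft>\<^sub>2 one (src (dom1 (dom2 \<phi>))) = \<phi>"
      "one (tgt (dom1 (dom2 \<phi>))) \<triangleright>\<^sub>2 \<phi> = \<phi>"


section \<open>Gray-monads\<close>

text \<open>\<open>To\<close> is the action of the endofunctor on objects of \<open>K\<close>, and \<open>T0\<close>, \<open>T1\<close>, \<open>T2\<close> are its
  actions on the 0-, 1- and 2-cells of the hom-2-categories.\<close>

record ('o, 'a, 'b, 'c) gray_endo =
  To :: "'o \<Rightarrow> 'o"
  T0 :: "'a \<Rightarrow> 'a"
  T1 :: "'b \<Rightarrow> 'b"
  T2 :: "'c \<Rightarrow> 'c"

locale gray_endofunctor = gray_category K
  for K :: "('o, 'a, 'b, 'c, 'z) gray_cat_scheme" (structure) +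
  fixes T :: "('o, 'a, 'b, 'c, 'y) gray_endo_scheme"
  assumes T0_bd: "src (T0 T f) = To T (src f)" "tgt (T0 T f) = To T (tgt f)"
    and T_functor: "strict_functor_on K UNIV K (T0 T) (T1 T) (T2 T)"
    and T_one: "T0 T (one A) = one (To T A)"
    and T_comp0: "src g = tgt f \<Longrightarrow> T0 T (g \<cdot> f) = T0 T g \<cdot> T0 T f"
    and T_whisk1:
      "src (dom1 \<alpha>) = tgt f \<Longrightarrow> T1 T (\<alpha> \<triangleleft> f) = T1 T \<alpha> \<triangleleft> T0 T f"
      "src g = tgt (dom1 \<beta>) \<Longrightarrow> T1 T (g \<triangleright> \<beta>) = T0 T g \<triangleright> T1 T \<beta>"
    and T_whisk2:
      "src (dom1 (dom2 \<phi>)) = tgt f \<Longrightarrow> T2 T (\<phi> \<triangleleft>\<^sub>2 f) = T2 T \<phi> \<triangleleft>\<^sub>2 T0 T f"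
      "src g = tgt (dom1 (dom2 \<psi>)) \<Longrightarrow> T2 T (g \<triangleright>\<^sub>2 \<psi>) = T0 T g \<triangleright>\<^sub>2 T2 T \<psi>"
    and T_interch:
      "src (dom1 \<alpha>) = tgt (dom1 \<beta>) \<Longrightarrow> T2 T \<Sigma>\<langle>\<alpha>, \<beta>\<rangle> = \<Sigma>\<langle>T1 T \<alpha>, T1 T \<beta>\<rangle>"

record ('o, 'a, 'b, 'c) gray_mnd = "('o, 'a, 'b, 'c) gray_endo" +
  mu :: "'o \<Rightarrow> 'a"
  eta :: "'o \<Rightarrow> 'a"

text \<open>Naturality of \<open>\<mu>\<close> and \<open>\<eta>\<close> is Gray-enriched, hence an equality of strict functors
  \<open>K(A,B) \<rightarrow> K(T\<^sup>2A,TB)\<close> and \<open>K(A,B) \<rightarrow> K(A,TB)\<close>.\<close>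

locale gray_monad = gray_endofunctor K T
  for K :: "('o, 'a, 'b, 'c, 'z) gray_cat_scheme" (structure)
    and T :: "('o, 'a, 'b, 'c, 'y) gray_mnd_scheme" +
  assumes mu_bd: "src (mu T A) = To T (To T A)" "tgt (mu T A) = To T A"
    and eta_bd: "src (eta T A) = A" "tgt (eta T A) = To T A"
    and mu_natural:
      "mu T (tgt f) \<cdot> T0 T (T0 T f) = T0 T f \<cdot> mu T (src f)"
      "mu T (tgt (dom1 \<alpha>)) \<triangleright> T1 T (T1 T \<alpha>) = T1 T \<alpha> \<triangleleft> mu T (src (dom1 \<alpha>))"
      "mu T (tgt (dom1 (dom2 \<phi>))) \<triangleright>\<^sub>2 T2 T (T2 T \<phi>) =
         T2 T \<phi> \<triangleleft>\<^sub>2 mu T (src (dom1 (dom2 \<phi>)))"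
    and eta_natural:
      "eta T (tgt f) \<cdot> f = T0 T f \<cdot> eta T (src f)"
      "eta T (tgt (dom1 \<alpha>)) \<triangleright> \<alpha> = T1 T \<alpha> \<triangleleft> eta T (src (dom1 \<alpha>))"
      "eta T (tgt (dom1 (dom2 \<phi>))) \<triangleright>\<^sub>2 \<phi> = T2 T \<phi> \<triangleleft>\<^sub>2 eta T (src (dom1 (dom2 \<phi>)))"
    and mu_assoc: "mu T A \<cdot> T0 T (mu T A) = mu T A \<cdot> mu T (To T A)"
    and mu_eta: "mu T A \<cdot> eta T (To T A) = one (To T A)"
    and mu_T_eta: "mu T A \<cdot> T0 T (eta T A) = one (To T A)"


section \<open>Pseudo algebras\<close>

text \<open>The adjoint equivalence \<open>m\<close> comes with its right adjoint \<open>m'\<close>, unit \<open>u\<^sub>m\<close> and counit \<open>e\<^sub>m\<close>,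
  and similarly for \<open>i\<close>.\<close>

locale pseudo_algebra_data = gray_monad K T
  for K :: "('o, 'a, 'b, 'c, 'z) gray_cat_scheme" (structure)
    and T :: "('o, 'a, 'b, 'c, 'y) gray_mnd_scheme" +
  fixes X :: 'o and x :: 'a
    and m m' :: 'b and u\<^sub>m e\<^sub>m :: 'c
    and i i' :: 'b and u\<^sub>i e\<^sub>i :: 'c
    and \<pi> lam \<rho> :: 'c
  assumes x_bd: "src x = To T X" "tgt x = X"
    and m_bd: "dom1 m = x \<cdot> T0 T x" "cod1 m = x \<cdot> mu T X"
    and m_adjoint_equivalence: "adjoint_equivalence K m m' u\<^sub>m e\<^sub>m"
    and i_bd: "dom1 i = one X" "cod1 i = x \<cdot> eta T X"
    and i_adjoint_equivalence: "adjoint_equivalence K i i' u\<^sub>i e\<^sub>i"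
    and \<pi>_bd:
      "dom2 \<pi> = (m \<triangleleft> mu T (To T X)) \<star> (m \<triangleleft> T0 T (T0 T x))"
      "cod2 \<pi> = (m \<triangleleft> T0 T (mu T X)) \<star> (x \<triangleright> T1 T m)"
    and \<pi>_invertible: "invertible2 K \<pi>"
    and lam_bd:
      "dom2 lam = (m \<triangleleft> eta T (To T X)) \<star> (i \<triangleleft> x)"
      "cod2 lam = id1 x"
    and lam_invertible: "invertible2 K lam"
    and \<rho>_bd:
      "dom2 \<rho> = (m \<triangleleft> T0 T (eta T X)) \<star> (x \<triangleright> T1 T i)"
      "cod2 \<rho> = id1 x"
    and \<rho>_invertible: "invertible2 K \<rho>"

context
  fixes K :: "('o, 'a, 'b, 'c, 'z) gray_cat_scheme" (structure)
    and T :: "('o, 'a, 'b, 'c, 'y) gray_mnd_scheme"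
    and X :: 'o and x :: 'a
begin

definition LAA1 :: "'b \<Rightarrow> 'c \<Rightarrow> bool" where
  "LAA1 m \<pi> \<longleftrightarrow>
     ((\<pi> \<triangleleft>\<^sub>2 T0 T (T0 T (mu T X))) \<star>\<^sub>2 id2 ((x \<cdot> T0 T x) \<triangleright> T1 T (T1 T m)))
     \<diamondop> (id2 (m \<triangleleft> T0 T (mu T X) \<triangleleft> mu T (To T (To T X))) \<star>\<^sub>2 vinv K \<Sigma>\<langle>m, T1 T (T1 T m)\<rangle>)
     \<diamondop> ((\<pi> \<triangleleft>\<^sub>2 mu T (To T (To T X))) \<star>\<^sub>2 id2 (m \<triangleleft> T0 T (T0 T x) \<triangleleft> T0 T (T0 T (T0 T x))))
     = (id2 (m \<triangleleft> T0 T (mu T X) \<triangleleft> T0 T (mu T (To T X))) \<star>\<^sub>2 (x \<triangleright>\<^sub>2 T2 T \<pi>))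
     \<diamondop> ((\<pi> \<triangleleft>\<^sub>2 T0 T (mu T (To T X))) \<star>\<^sub>2 id2 ((x \<triangleright> T1 T m) \<triangleleft> T0 T (T0 T (T0 T x))))
     \<diamondop> (id2 (m \<triangleleft> mu T (To T X) \<triangleleft> mu T (To T (To T X))) \<star>\<^sub>2 (\<pi> \<triangleleft>\<^sub>2 T0 T (T0 T (T0 T x))))"

definition LAA2 :: "'b \<Rightarrow> 'b \<Rightarrow> 'c \<Rightarrow> 'c \<Rightarrow> bool" where
  "LAA2 m i \<pi> \<rho> \<longleftrightarrow>
     ((\<rho> \<triangleleft>\<^sub>2 mu T X) \<star>\<^sub>2 id2 m)
     \<diamondop> (id2 (m \<triangleleft> mu T (To T X) \<triangleleft> T0 T (T0 T (eta T X))) \<star>\<^sub>2 \<Sigma>\<langle>m, T1 T (T1 T i)\<rangle>)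
     = (id2 m \<star>\<^sub>2 (x \<triangleright>\<^sub>2 T2 T \<rho>))
     \<diamondop> ((\<pi> \<triangleleft>\<^sub>2 T0 T (T0 T (eta T X))) \<star>\<^sub>2 id2 ((x \<cdot> T0 T x) \<triangleright> T1 T (T1 T i)))"

definition LAA3 :: "'b \<Rightarrow> 'b \<Rightarrow> 'c \<Rightarrow> 'c \<Rightarrow> bool" where
  "LAA3 m i \<pi> lam \<longleftrightarrow>
     id2 m \<star>\<^sub>2 (lam \<triangleleft>\<^sub>2 T0 T x)
     = ((lam \<triangleleft>\<^sub>2 mu T X) \<star>\<^sub>2 id2 m)
     \<diamondop> (id2 (m \<triangleleft> eta T (To T X) \<triangleleft> mu T X) \<star>\<^sub>2 vinv K \<Sigma>\<langle>i, m\<rangle>)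
     \<diamondop> ((\<pi> \<triangleleft>\<^sub>2 eta T (To T (To T X))) \<star>\<^sub>2 id2 (i \<triangleleft> x \<triangleleft> T0 T x))"

definition LAA4 :: "'b \<Rightarrow> 'b \<Rightarrow> 'c \<Rightarrow> 'c \<Rightarrow> 'c \<Rightarrow> bool" where
  "LAA4 m i \<pi> lam \<rho> \<longleftrightarrow>
     (id2 m \<star>\<^sub>2 (x \<triangleright>\<^sub>2 T2 T lam))
     \<diamondop> ((\<pi> \<triangleleft>\<^sub>2 T0 T (eta T (To T X))) \<star>\<^sub>2 id2 ((x \<triangleright> T1 T i) \<triangleleft> T0 T x))
     = id2 m \<star>\<^sub>2 (\<rho> \<triangleleft>\<^sub>2 T0 T x)"

end

end

theory Submission imports Defs begin

text \<open>The axioms (LAA1) and (LAA4) are a pentagon and a middle unit triangle, and the argument is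
  Kelly's for monoidal categories: the two outer unit triangles follow from the pentagon with a unit
  inserted and two instances of the middle triangle, by cancelling equivalences.

  For (LAA3), restrict the pentagon along \<open>T\<eta>\<close> at \<open>T\<^sup>2X\<close> and compose it with \<open>x Ti Tx T\<^sup>2x\<close>. Two of the
  five cells \<open>\<pi>\<close> now have the form \<open>\<pi> T\<eta>\<close> that occurs in (LAA4), so they can be traded for \<open>\<lambda>\<close> and
  \<open>\<rho>\<close>. The two copies of \<open>\<rho>\<close> that arise agree by naturality of the interchange cells, and there
  remains \<open>x T(-)\<close> applied to (LAA3), composed with \<open>m T\<mu>\<close>. For (LAA2), restrict the pentagon along
  \<open>T\<^sup>2\<eta>\<close> at \<open>TX\<close> and compose it with \<open>x Tx T\<^sup>2i T\<^sup>2x\<close>; this time the two copies of \<open>\<lambda>\<close> agree, and there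
  remains (LAA2) restricted along \<open>T\<^sup>2x\<close>, composed with \<open>m \<mu>\<close> at \<open>TX\<close>. Once the whiskered cells are
  named, both computations take place in a single 2-category (\<open>left_unit_pasting\<close> and
  \<open>right_unit_pasting\<close>).

  It remains to remove what has been added. Composing with a whiskered copy of the equivalence \<open>m\<close> is
  faithful on 2-cells (\<open>pseudo_section_cancel\<close>). The operations \<open>x T(-)\<close> and \<open>(-) T\<^sup>2x\<close> are faithful
  because \<open>x T(-) \<eta> = (x \<eta>) (-)\<close> and \<open>(-) T\<^sup>2x T\<^sup>2\<eta> = (-) T\<^sup>2(x \<eta>)\<close>, where whiskering by \<open>x \<eta>\<close> differs
  from the identity only by the equivalence \<open>i : 1 \<rightarrow> x \<eta>\<close>, naturally by the interchange cells
  (\<open>pseudo_section_lwhisk_faithful\<close>, \<open>pseudo_section_rwhisk_faithful\<close>).\<close>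


section \<open>Cancellation in a 2-category\<close>

context two_category
begin

lemmas bd = id1_bd comp1_bd globular id2_bd vcomp_bd hcomp_bd

lemma whisker_vcomp:
  assumes "dom2 \<psi> = cod2 \<phi>"
  shows "dom1 f = cod1 (dom2 \<phi>) \<Longrightarrow> id2 f \<star>\<^sub>2 (\<psi> \<diamondop> \<phi>) = (id2 f \<star>\<^sub>2 \<psi>) \<diamondop> (id2 f \<star>\<^sub>2 \<phi>)"
    and "dom1 (dom2 \<phi>) = cod1 f \<Longrightarrow> (\<psi> \<diamondop> \<phi>) \<star>\<^sub>2 id2 f = (\<psi> \<star>\<^sub>2 id2 f) \<diamondop> (\<phi> \<star>\<^sub>2 id2 f)"
  using assms interchange[of "id2 f" "id2 f" \<psi> \<phi>] interchange[of \<psi> \<phi> "id2 f" "id2 f"]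
    vcomp_id(1)[of "id2 f"] by (simp_all add: bd)

lemma whisker_exchange:
  assumes "dom1 (dom2 \<psi>) = cod1 (dom2 \<phi>)"
  shows "(id2 (cod2 \<psi>) \<star>\<^sub>2 \<phi>) \<diamondop> (\<psi> \<star>\<^sub>2 id2 (dom2 \<phi>)) = (\<psi> \<star>\<^sub>2 id2 (cod2 \<phi>)) \<diamondop> (id2 (dom2 \<psi>) \<star>\<^sub>2 \<phi>)"
proof -
  have "(id2 (cod2 \<psi>) \<star>\<^sub>2 \<phi>) \<diamondop> (\<psi> \<star>\<^sub>2 id2 (dom2 \<phi>)) = \<psi> \<star>\<^sub>2 \<phi>"
    using interchange[of "id2 (cod2 \<psi>)" \<psi> \<phi> "id2 (dom2 \<phi>)"] assms by (simp add: bd vcomp_id)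
  moreover have "(\<psi> \<star>\<^sub>2 id2 (cod2 \<phi>)) \<diamondop> (id2 (dom2 \<psi>) \<star>\<^sub>2 \<phi>) = \<psi> \<star>\<^sub>2 \<phi>"
    using interchange[of \<psi> "id2 (dom2 \<psi>)" "id2 (cod2 \<phi>)" \<phi>] assms by (simp add: bd vcomp_id)
  ultimately show ?thesis by simp
qed

lemma whisker_comp1:
  assumes "dom1 g = cod1 f" "dom1 f = cod1 (dom2 \<phi>)"
  shows "id2 (g \<star> f) \<star>\<^sub>2 \<phi> = id2 g \<star>\<^sub>2 (id2 f \<star>\<^sub>2 \<phi>)"
  using assms by (simp add: hcomp_id2[symmetric] hcomp_assoc bd)

lemma vinv_eqI:
  assumes "inverse2 C \<theta> \<phi>"
  shows "vinv C \<theta> = \<phi>"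
  unfolding vinv_def
proof (rule the_equality, rule assms)
  fix \<chi> assume "inverse2 C \<theta> \<chi>"
  with assms show "\<chi> = \<phi>"
    unfolding inverse2_def by (metis vcomp_assoc vcomp_id(1) vcomp_id(2))
qed

lemma vinv_inverse2: "invertible2 C \<theta> \<Longrightarrow> inverse2 C \<theta> (vinv C \<theta>)"
  using vinv_eqI invertible2_def by metis

lemma invertible2_cancel_left:
  assumes "invertible2 C \<theta>" "dom2 \<theta> = cod2 \<phi>" "dom2 \<theta> = cod2 \<psi>" "\<theta> \<diamondop> \<phi> = \<theta> \<diamondop> \<psi>"
  shows "\<phi> = \<psi>"
  using assms unfolding invertible2_def inverse2_def by (metis vcomp_assoc vcomp_id(2))

lemma invertible2_cancel_right:
  assumes "invertible2 C \<theta>" "cod2 \<theta> = dom2 \<phi>" "cod2 \<theta> = dom2 \<psi>" "\<phi> \<diamondop> \<theta> = \<psi> \<diamondop> \<theta>"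
  shows "\<phi> = \<psi>"
  using assms unfolding invertible2_def inverse2_def by (metis vcomp_assoc vcomp_id(1))

lemma invertible2_vcomp:
  assumes "invertible2 C \<psi>" "invertible2 C \<phi>" "dom2 \<psi> = cod2 \<phi>"
  shows "invertible2 C (\<psi> \<diamondop> \<phi>)"
proof -
  obtain \<psi>' \<phi>' where inv: "inverse2 C \<psi> \<psi>'" "inverse2 C \<phi> \<phi>'"
    using assms(1,2) unfolding invertible2_def by blast
  have "\<psi>' \<diamondop> (\<psi> \<diamondop> \<phi>) = \<phi>" "\<phi> \<diamondop> (\<phi>' \<diamondop> \<psi>') = \<psi>'"
    using inv assms(3) vcomp_assoc[of \<psi>' \<psi> \<phi>] vcomp_assoc[of \<phi> \<phi>' \<psi>']
      vcomp_id(2)[of \<phi>] vcomp_id(2)[of \<psi>']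
    unfolding inverse2_def by (simp_all add: bd)
  then have "inverse2 C (\<psi> \<diamondop> \<phi>) (\<phi>' \<diamondop> \<psi>')"
    using inv assms(3) unfolding inverse2_def by (simp add: bd vcomp_assoc)
  then show ?thesis unfolding invertible2_def by blast
qed

lemma inverse2_whisker_left:
  assumes "inverse2 C \<theta> \<phi>" "dom1 f = cod1 (dom2 \<theta>)"
  shows "inverse2 C (id2 f \<star>\<^sub>2 \<theta>) (id2 f \<star>\<^sub>2 \<phi>)"
proof -
  have "cod1 (dom2 \<phi>) = cod1 (dom2 \<theta>)" using assms globular unfolding inverse2_def by metis
  then show ?thesis using assms unfolding inverse2_def
   by (simp add: bd whisker_vcomp[symmetric] hcomp_id2)
qed

lemma inverse2_whisker_right:
  assumes "inverse2 C \<theta> \<phi>" "dom1 (dom2 \<theta>) = cod1 f"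
  shows "inverse2 C (\<theta> \<star>\<^sub>2 id2 f) (\<phi> \<star>\<^sub>2 id2 f)"
proof -
  have "dom1 (dom2 \<phi>) = dom1 (dom2 \<theta>)" using assms globular unfolding inverse2_def by metis
  then show ?thesis using assms unfolding inverse2_def
   by (simp add: bd whisker_vcomp[symmetric] hcomp_id2)
qed

lemma invertible2_whisker:
  assumes "invertible2 C \<theta>"
  shows "dom1 f = cod1 (dom2 \<theta>) \<Longrightarrow> invertible2 C (id2 f \<star>\<^sub>2 \<theta>)"
    and "dom1 (dom2 \<theta>) = cod1 f \<Longrightarrow> invertible2 C (\<theta> \<star>\<^sub>2 id2 f)"
  using assms inverse2_whisker_left inverse2_whisker_right unfolding invertible2_def by blast+

text \<open>A left inverse up to isomorphism is the half of an equivalence that cancellation on the left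
  needs, and, unlike an adjoint equivalence, it has no coherence data to transport along functors.\<close>
definition pseudo_section :: "'b \<Rightarrow> bool" where
  "pseudo_section f \<longleftrightarrow>
     (\<exists>g u. dom1 g = cod1 f \<and> dom2 u = id1 (dom1 f) \<and> cod2 u = g \<star> f \<and> invertible2 C u)"

lemma pseudo_section_cancel:
  assumes "pseudo_section f"
    and par: "dom2 \<phi> = dom2 \<psi>" "cod2 \<phi> = cod2 \<psi>" "dom1 f = cod1 (dom2 \<phi>)"
    and eq: "id2 f \<star>\<^sub>2 \<phi> = id2 f \<star>\<^sub>2 \<psi>"
  shows "\<phi> = \<psi>"
proof -
  obtain g u where gu: "dom1 g = cod1 f" "dom2 u = id1 (dom1 f)" "cod2 u = g \<star> f" "invertible2 C u"
    using assms(1) unfolding pseudo_section_def by blast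
  have d: "dom1 (dom2 u) = dom1 f" "dom1 (cod2 u) = dom1 f" using gu by (simp_all add: bd)
  have *: "(u \<star>\<^sub>2 id2 (cod2 \<chi>)) \<diamondop> \<chi> = (id2 g \<star>\<^sub>2 (id2 f \<star>\<^sub>2 \<chi>)) \<diamondop> (u \<star>\<^sub>2 id2 (dom2 \<chi>))"
    if "dom1 f = cod1 (dom2 \<chi>)" for \<chi>
  proof -
    have "id2 (dom2 u) \<star>\<^sub>2 \<chi> = \<chi>" using that gu hcomp_id(2)[of \<chi>] by simp
    then show ?thesis
      using whisker_exchange[of u \<chi>] that d whisker_comp1[of g f \<chi>] gu(1,3) by simp
  qed
  have "(u \<star>\<^sub>2 id2 (cod2 \<phi>)) \<diamondop> \<phi> = (u \<star>\<^sub>2 id2 (cod2 \<phi>)) \<diamondop> \<psi>"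
    using *[of \<phi>] *[of \<psi>] eq par by simp
  moreover have "invertible2 C (u \<star>\<^sub>2 id2 (cod2 \<phi>))"
    by (rule invertible2_whisker(2)[OF gu(4)]) (simp add: par(3) d globular)
  moreover have "dom2 (u \<star>\<^sub>2 id2 (cod2 \<phi>)) = cod2 \<phi>"
  proof -
    have "id1 (cod1 (cod2 \<phi>)) \<star> cod2 \<phi> = cod2 \<phi>" by (rule comp1_id)
    then show ?thesis using par(3) gu by (simp add: bd)
  qed
  ultimately show ?thesis using invertible2_cancel_left par(2) by metis
qed

lemma vinv_bd [simp]:
  "invertible2 C \<theta> \<Longrightarrow> dom2 (vinv C \<theta>) = cod2 \<theta>"
  "invertible2 C \<theta> \<Longrightarrow> cod2 (vinv C \<theta>) = dom2 \<theta>"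
  using vinv_inverse2 unfolding inverse2_def by auto

lemma vcomp_id_cond:
  "dom2 \<phi> = f \<Longrightarrow> \<phi> \<diamondop> id2 f = \<phi>"
  "cod2 \<phi> = f \<Longrightarrow> id2 f \<diamondop> \<phi> = \<phi>"
  using vcomp_id by auto

lemma comp1_id_cond:
  "dom1 f = a \<Longrightarrow> f \<star> id1 a = f"
  "cod1 f = a \<Longrightarrow> id1 a \<star> f = f"
  using comp1_id by auto

lemma transpose_right:
  assumes "inverse2 C \<theta> \<theta>'" "\<phi> = \<psi> \<diamondop> \<theta>" "dom2 \<psi> = cod2 \<theta>"
  shows "\<psi> = \<phi> \<diamondop> \<theta>'"
  using assms vcomp_assoc[of \<psi> \<theta> \<theta>'] vcomp_id(1)[of \<psi>] unfolding inverse2_def by simp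


section \<open>Pentagon and middle triangle imply the outer triangles\<close>

text \<open>The cells \<open>\<pi>\<close>, \<open>\<pi>'\<close>, \<open>\<pi>''\<close> and \<open>t\<close> are the associativity cells of a pentagon and \<open>s\<close> is its
  interchange cell; \<open>L\<close>, \<open>L'\<close> and \<open>R\<close>, \<open>R'\<close> are two copies each of the left and the right unit cell.
  Paste \<open>L'\<close> onto the pentagon: it turns \<open>\<pi>''\<close> into \<open>R'\<close>, which moves past the interchange cells and
  becomes \<open>R\<close>, and \<open>R\<close> is \<open>L\<close> composed with \<open>\<pi>'\<close>. So the two sides agree after composition with \<open>\<pi>\<close>
  and \<open>\<pi>'\<close>, which are invertible.\<close>
lemma left_unit_pasting:
  assumes one_cells:
      "dom1 q = cod1 a" "dom1 p = cod1 b" "cod1 p = cod1 q"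
      "dom1 b = dom1 a" "cod1 c = dom1 a" "cod1 d = dom1 a" "dom1 d = dom1 c"
      "cod1 j = dom1 c" "dom1 j = dom1 a"
      "cod1 c' = cod1 b" "cod1 d' = cod1 b" "dom1 d' = dom1 c'"
      "cod1 e = dom1 c'" "dom1 e = dom1 c" "cod1 j' = dom1 c'" "dom1 j' = cod1 b"
    and bd_\<pi>: "dom2 \<pi> = q \<star> a" "cod2 \<pi> = p \<star> b"
    and bd_\<pi>': "dom2 \<pi>' = a \<star> c" "cod2 \<pi>' = a \<star> d"
    and bd_\<pi>'': "dom2 \<pi>'' = p \<star> c'" "cod2 \<pi>'' = p \<star> d'"
    and bd_st: "dom2 s = b \<star> c" "cod2 s = c' \<star> e" "dom2 t = b \<star> d" "cod2 t = d' \<star> e"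
    and bd_\<sigma>: "dom2 \<sigma> = e \<star> j" "cod2 \<sigma> = j' \<star> b"
    and bd_L: "dom2 L = d \<star> j" "cod2 L = id1 (dom1 a)" "dom2 L' = d' \<star> j'" "cod2 L' = id1 (cod1 b)"
    and bd_R: "dom2 R = c \<star> j" "cod2 R = id1 (dom1 a)" "dom2 R' = c' \<star> j'" "cod2 R' = id1 (cod1 b)"
    and inv: "invertible2 C \<pi>" "invertible2 C \<pi>'"
    and pentagon:
      "(\<pi>'' \<star>\<^sub>2 id2 e) \<diamondop> (id2 p \<star>\<^sub>2 s) \<diamondop> (\<pi> \<star>\<^sub>2 id2 c) = (id2 p \<star>\<^sub>2 t) \<diamondop> (\<pi> \<star>\<^sub>2 id2 d) \<diamondop> (id2 q \<star>\<^sub>2 \<pi>')"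
    and triangle: "(id2 a \<star>\<^sub>2 L) \<diamondop> (\<pi>' \<star>\<^sub>2 id2 j) = id2 a \<star>\<^sub>2 R"
    and triangle': "(id2 p \<star>\<^sub>2 L') \<diamondop> (\<pi>'' \<star>\<^sub>2 id2 j') = id2 p \<star>\<^sub>2 R'"
    and nat: "id2 b \<star>\<^sub>2 R = (R' \<star>\<^sub>2 id2 b) \<diamondop> (id2 c' \<star>\<^sub>2 \<sigma>) \<diamondop> (s \<star>\<^sub>2 id2 j)"
  shows "id2 p \<star>\<^sub>2 (id2 b \<star>\<^sub>2 L) = id2 p \<star>\<^sub>2 ((L' \<star>\<^sub>2 id2 b) \<diamondop> (id2 d' \<star>\<^sub>2 \<sigma>) \<diamondop> (t \<star>\<^sub>2 id2 j))"
proof -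
  have units: "p \<star> (b \<star> id1 (dom1 a)) = p \<star> b" "q \<star> (a \<star> id1 (dom1 a)) = q \<star> a" "id1 (cod1 b) \<star> b = b"
    "b \<star> id1 (dom1 a) = b" "a \<star> id1 (dom1 a) = a" "p \<star> id1 (cod1 b) = p"
    using comp1_id(1)[of b] comp1_id(1)[of a] comp1_id(2)[of b] comp1_id(1)[of p] one_cells by auto
  have bds:
    "dom1 (dom2 \<pi>) = dom1 a" "cod1 (dom2 \<pi>) = cod1 q" "dom1 (dom2 \<pi>') = dom1 c"
    "cod1 (dom2 \<pi>') = cod1 a" "dom1 (dom2 \<pi>'') = dom1 c'" "cod1 (dom2 \<pi>'') = cod1 q"
    "dom1 (dom2 L) = dom1 a" "cod1 (dom2 L) = dom1 a" "dom1 (dom2 L') = cod1 b"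
    "cod1 (dom2 L') = cod1 b" "dom1 (dom2 R) = dom1 a" "cod1 (dom2 R) = dom1 a"
    "dom1 (dom2 R') = cod1 b" "cod1 (dom2 R') = cod1 b" "dom1 (dom2 \<sigma>) = dom1 a"
    "cod1 (dom2 \<sigma>) = dom1 c'" "dom1 (dom2 s) = dom1 c" "cod1 (dom2 s) = cod1 b"
    "dom1 (dom2 t) = dom1 c" "cod1 (dom2 t) = cod1 b"
    using one_cells by (simp_all add: assms(17-36) bd)
  note types = one_cells assms(17-36) bds units
  note normalize = bd types comp1_assoc hcomp_assoc hcomp_id2 whisker_comp1 whisker_vcomp vcomp_assoc
  have \<pi>_unit: "\<pi> \<star>\<^sub>2 id2 (id1 (dom1 a)) = \<pi>" using hcomp_id(1)[of \<pi>] by (simp add: bds)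
  have slide_L: "(id2 p \<star>\<^sub>2 (id2 b \<star>\<^sub>2 L)) \<diamondop> (\<pi> \<star>\<^sub>2 id2 (d \<star> j)) = \<pi> \<diamondop> (id2 q \<star>\<^sub>2 (id2 a \<star>\<^sub>2 L))"
    using whisker_exchange[of \<pi> L] by (simp add: normalize \<pi>_unit)
  have slide_R: "(id2 p \<star>\<^sub>2 (id2 b \<star>\<^sub>2 R)) \<diamondop> (\<pi> \<star>\<^sub>2 id2 (c \<star> j)) = \<pi> \<diamondop> (id2 q \<star>\<^sub>2 (id2 a \<star>\<^sub>2 R))"
    using whisker_exchange[of \<pi> R] by (simp add: normalize \<pi>_unit)
  have tri: "(id2 q \<star>\<^sub>2 (id2 a \<star>\<^sub>2 R)) = (id2 q \<star>\<^sub>2 (id2 a \<star>\<^sub>2 L)) \<diamondop> (id2 q \<star>\<^sub>2 (\<pi>' \<star>\<^sub>2 id2 j))"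
    unfolding triangle[symmetric] by (simp add: normalize)
  have tri': "(id2 p \<star>\<^sub>2 (L' \<star>\<^sub>2 id2 b)) \<diamondop> (\<pi>'' \<star>\<^sub>2 id2 (j' \<star> b)) = id2 p \<star>\<^sub>2 (R' \<star>\<^sub>2 id2 b)"
    using arg_cong[OF triangle', of "\<lambda>z. z \<star>\<^sub>2 id2 b"] by (simp add: normalize)
  have slide_\<sigma>: "(id2 p \<star>\<^sub>2 (id2 d' \<star>\<^sub>2 \<sigma>)) \<diamondop> (\<pi>'' \<star>\<^sub>2 id2 (e \<star> j))
      = (\<pi>'' \<star>\<^sub>2 id2 (j' \<star> b)) \<diamondop> (id2 p \<star>\<^sub>2 (id2 c' \<star>\<^sub>2 \<sigma>))"
    using whisker_exchange[of \<pi>'' \<sigma>] by (simp add: normalize)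
  have nat': "id2 p \<star>\<^sub>2 (id2 b \<star>\<^sub>2 R) = (id2 p \<star>\<^sub>2 (R' \<star>\<^sub>2 id2 b))
      \<diamondop> ((id2 p \<star>\<^sub>2 (id2 c' \<star>\<^sub>2 \<sigma>)) \<diamondop> (id2 p \<star>\<^sub>2 (s \<star>\<^sub>2 id2 j)))"
    unfolding nat by (simp add: normalize)
  have pent: "(\<pi>'' \<star>\<^sub>2 id2 (e \<star> j)) \<diamondop> ((id2 p \<star>\<^sub>2 (s \<star>\<^sub>2 id2 j)) \<diamondop> (\<pi> \<star>\<^sub>2 id2 (c \<star> j))) =
    (id2 p \<star>\<^sub>2 (t \<star>\<^sub>2 id2 j)) \<diamondop> ((\<pi> \<star>\<^sub>2 id2 (d \<star> j)) \<diamondop> (id2 q \<star>\<^sub>2 (\<pi>' \<star>\<^sub>2 id2 j)))"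
    using arg_cong[OF pentagon, of "\<lambda>z. z \<star>\<^sub>2 id2 j"] by (simp add: normalize)
  let ?U = "(\<pi> \<star>\<^sub>2 id2 (d \<star> j)) \<diamondop> (id2 q \<star>\<^sub>2 (\<pi>' \<star>\<^sub>2 id2 j))"
  have "(id2 p \<star>\<^sub>2 (L' \<star>\<^sub>2 id2 b)) \<diamondop> ((id2 p \<star>\<^sub>2 (id2 d' \<star>\<^sub>2 \<sigma>)) \<diamondop> ((id2 p \<star>\<^sub>2 (t \<star>\<^sub>2 id2 j)) \<diamondop> ?U))
    = (id2 p \<star>\<^sub>2 (L' \<star>\<^sub>2 id2 b)) \<diamondop> (((id2 p \<star>\<^sub>2 (id2 d' \<star>\<^sub>2 \<sigma>)) \<diamondop> (\<pi>'' \<star>\<^sub>2 id2 (e \<star> j)))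
        \<diamondop> ((id2 p \<star>\<^sub>2 (s \<star>\<^sub>2 id2 j)) \<diamondop> (\<pi> \<star>\<^sub>2 id2 (c \<star> j))))"
    unfolding pent[symmetric] by (simp add: normalize)
  also have "\<dots> = ((id2 p \<star>\<^sub>2 (L' \<star>\<^sub>2 id2 b)) \<diamondop> (\<pi>'' \<star>\<^sub>2 id2 (j' \<star> b)))
      \<diamondop> ((id2 p \<star>\<^sub>2 (id2 c' \<star>\<^sub>2 \<sigma>)) \<diamondop> ((id2 p \<star>\<^sub>2 (s \<star>\<^sub>2 id2 j)) \<diamondop> (\<pi> \<star>\<^sub>2 id2 (c \<star> j))))"
    unfolding slide_\<sigma> by (simp add: normalize)
  also have "\<dots> = (id2 p \<star>\<^sub>2 (id2 b \<star>\<^sub>2 R)) \<diamondop> (\<pi> \<star>\<^sub>2 id2 (c \<star> j))"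
    unfolding tri' nat' by (simp add: normalize)
  also have "\<dots> = (\<pi> \<diamondop> (id2 q \<star>\<^sub>2 (id2 a \<star>\<^sub>2 L))) \<diamondop> (id2 q \<star>\<^sub>2 (\<pi>' \<star>\<^sub>2 id2 j))"
    unfolding slide_R tri by (simp add: normalize)
  also have "\<dots> = (id2 p \<star>\<^sub>2 (id2 b \<star>\<^sub>2 L)) \<diamondop> ?U"
    unfolding slide_L[symmetric] by (simp add: normalize)
  finally have eq: "(id2 p \<star>\<^sub>2 ((L' \<star>\<^sub>2 id2 b) \<diamondop> (id2 d' \<star>\<^sub>2 \<sigma>) \<diamondop> (t \<star>\<^sub>2 id2 j))) \<diamondop> ?U
      = (id2 p \<star>\<^sub>2 (id2 b \<star>\<^sub>2 L)) \<diamondop> ?U"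
    by (simp add: normalize)
  have "invertible2 C (\<pi> \<star>\<^sub>2 id2 (d \<star> j))" "invertible2 C (id2 q \<star>\<^sub>2 (\<pi>' \<star>\<^sub>2 id2 j))"
    by (intro invertible2_whisker inv; simp add: normalize)+
  then have "invertible2 C ?U" by (rule invertible2_vcomp) (simp add: normalize)
  from invertible2_cancel_right[OF this _ _ eq] show ?thesis by (simp add: normalize)
qed

text \<open>Here \<open>\<pi>\<close>, \<open>\<pi>\<^sub>1\<close>, \<open>\<pi>\<^sub>2\<close>, \<open>\<pi>\<^sub>3\<close> are the associativity cells of the pentagon. Now it is \<open>L\<close> that, pasted
  onto the pentagon, turns \<open>\<pi>\<^sub>3\<close> into \<open>R\<close>; on the other side of the pentagon \<open>L\<close> moves past the
  interchange cells and becomes \<open>L'\<close>, which turns \<open>\<pi>\<^sub>1\<close> into \<open>R'\<close>. The cell \<open>\<pi>\<close> ends up outermost on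
  both sides and is cancelled.\<close>
lemma right_unit_pasting:
  assumes one_cells:
      "dom1 q = cod1 a" "dom1 p = cod1 b" "cod1 p = cod1 q" "dom1 b = dom1 a"
      "cod1 c\<^sub>1 = cod1 a" "cod1 d\<^sub>1 = cod1 a" "dom1 d\<^sub>1 = dom1 c\<^sub>1" "cod1 h = dom1 c\<^sub>1"
      "cod1 g = dom1 a" "dom1 g = dom1 h" "cod1 c\<^sub>2 = dom1 a" "dom1 c\<^sub>2 = dom1 h"
      "cod1 k = dom1 h" "dom1 k = dom1 a" "cod1 j = dom1 c\<^sub>1" "dom1 j = cod1 a"
    and bd_\<pi>: "dom2 \<pi> = q \<star> a" "cod2 \<pi> = p \<star> b"
    and bd_\<pi>\<^sub>1: "dom2 \<pi>\<^sub>1 = q \<star> c\<^sub>1" "cod2 \<pi>\<^sub>1 = q \<star> d\<^sub>1"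
    and bd_\<pi>\<^sub>2: "dom2 \<pi>\<^sub>2 = c\<^sub>1 \<star> h" "cod2 \<pi>\<^sub>2 = a \<star> c\<^sub>2"
    and bd_\<pi>\<^sub>3: "dom2 \<pi>\<^sub>3 = b \<star> c\<^sub>2" "cod2 \<pi>\<^sub>3 = b \<star> g"
    and bd_s: "dom2 s = d\<^sub>1 \<star> h" "cod2 s = a \<star> g"
    and bd_\<sigma>: "dom2 \<sigma> = h \<star> k" "cod2 \<sigma> = j \<star> a"
    and bd_L: "dom2 L = g \<star> k" "cod2 L = id1 (dom1 a)" "dom2 L' = d\<^sub>1 \<star> j" "cod2 L' = id1 (cod1 a)"
    and bd_R: "dom2 R = c\<^sub>2 \<star> k" "cod2 R = id1 (dom1 a)" "dom2 R' = c\<^sub>1 \<star> j" "cod2 R' = id1 (cod1 a)"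
    and inv: "invertible2 C \<pi>"
    and pentagon:
      "(\<pi> \<star>\<^sub>2 id2 g) \<diamondop> (id2 q \<star>\<^sub>2 s) \<diamondop> (\<pi>\<^sub>1 \<star>\<^sub>2 id2 h)
          = (id2 p \<star>\<^sub>2 \<pi>\<^sub>3) \<diamondop> (\<pi> \<star>\<^sub>2 id2 c\<^sub>2) \<diamondop> (id2 q \<star>\<^sub>2 \<pi>\<^sub>2)"
    and triangle: "(id2 b \<star>\<^sub>2 L) \<diamondop> (\<pi>\<^sub>3 \<star>\<^sub>2 id2 k) = id2 b \<star>\<^sub>2 R"
    and triangle': "(id2 q \<star>\<^sub>2 L') \<diamondop> (\<pi>\<^sub>1 \<star>\<^sub>2 id2 j) = id2 q \<star>\<^sub>2 R'"
    and nat: "(id2 a \<star>\<^sub>2 L) \<diamondop> (s \<star>\<^sub>2 id2 k) = (L' \<star>\<^sub>2 id2 a) \<diamondop> (id2 d\<^sub>1 \<star>\<^sub>2 \<sigma>)"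
  shows "id2 q \<star>\<^sub>2 ((R' \<star>\<^sub>2 id2 a) \<diamondop> (id2 c\<^sub>1 \<star>\<^sub>2 \<sigma>)) = id2 q \<star>\<^sub>2 ((id2 a \<star>\<^sub>2 R) \<diamondop> (\<pi>\<^sub>2 \<star>\<^sub>2 id2 k))"
proof -
  have units: "p \<star> (b \<star> id1 (dom1 a)) = p \<star> b" "q \<star> (a \<star> id1 (dom1 a)) = q \<star> a" "id1 (cod1 a) \<star> a = a"
    "b \<star> id1 (dom1 a) = b" "a \<star> id1 (dom1 a) = a" "q \<star> id1 (cod1 a) = q"
    using comp1_id(1)[of b] comp1_id(1)[of a] comp1_id(2)[of a] comp1_id(1)[of q] one_cells by auto
  have bds:
    "dom1 (dom2 \<pi>) = dom1 a" "cod1 (dom2 \<pi>) = cod1 q" "dom1 (dom2 \<pi>\<^sub>1) = dom1 c\<^sub>1"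
    "cod1 (dom2 \<pi>\<^sub>1) = cod1 q" "dom1 (dom2 \<pi>\<^sub>2) = dom1 h" "cod1 (dom2 \<pi>\<^sub>2) = cod1 a"
    "dom1 (dom2 \<pi>\<^sub>3) = dom1 h" "cod1 (dom2 \<pi>\<^sub>3) = cod1 b" "dom1 (dom2 L) = dom1 a"
    "cod1 (dom2 L) = dom1 a" "dom1 (dom2 L') = cod1 a" "cod1 (dom2 L') = cod1 a"
    "dom1 (dom2 R) = dom1 a" "cod1 (dom2 R) = dom1 a" "dom1 (dom2 R') = cod1 a"
    "cod1 (dom2 R') = cod1 a" "dom1 (dom2 \<sigma>) = dom1 a" "cod1 (dom2 \<sigma>) = dom1 c\<^sub>1"
    "dom1 (dom2 s) = dom1 h" "cod1 (dom2 s) = cod1 a"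
    using one_cells by (simp_all add: assms(17-36) bd)
  note types = one_cells assms(17-36) bds units
  note normalize = bd types comp1_assoc hcomp_assoc hcomp_id2 whisker_comp1 whisker_vcomp vcomp_assoc
  have \<pi>_unit: "\<pi> \<star>\<^sub>2 id2 (id1 (dom1 a)) = \<pi>" using hcomp_id(1)[of \<pi>] by (simp add: bds)
  have slide_R: "\<pi> \<diamondop> (id2 q \<star>\<^sub>2 (id2 a \<star>\<^sub>2 R)) = (id2 p \<star>\<^sub>2 (id2 b \<star>\<^sub>2 R)) \<diamondop> (\<pi> \<star>\<^sub>2 id2 (c\<^sub>2 \<star> k))"
    using whisker_exchange[of \<pi> R] by (simp add: normalize \<pi>_unit)
  have slide_L: "(id2 p \<star>\<^sub>2 (id2 b \<star>\<^sub>2 L)) \<diamondop> (\<pi> \<star>\<^sub>2 id2 (g \<star> k)) = \<pi> \<diamondop> (id2 q \<star>\<^sub>2 (id2 a \<star>\<^sub>2 L))"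
    using whisker_exchange[of \<pi> L] by (simp add: normalize \<pi>_unit)
  have tri: "id2 p \<star>\<^sub>2 (id2 b \<star>\<^sub>2 R) = (id2 p \<star>\<^sub>2 (id2 b \<star>\<^sub>2 L)) \<diamondop> (id2 p \<star>\<^sub>2 (\<pi>\<^sub>3 \<star>\<^sub>2 id2 k))"
    unfolding triangle[symmetric] by (simp add: normalize)
  have tri': "(id2 q \<star>\<^sub>2 (L' \<star>\<^sub>2 id2 a)) \<diamondop> (\<pi>\<^sub>1 \<star>\<^sub>2 id2 (j \<star> a)) = id2 q \<star>\<^sub>2 (R' \<star>\<^sub>2 id2 a)"
    using arg_cong[OF triangle', of "\<lambda>z. z \<star>\<^sub>2 id2 a"] by (simp add: normalize)
  have slide_\<sigma>: "(id2 q \<star>\<^sub>2 (id2 d\<^sub>1 \<star>\<^sub>2 \<sigma>)) \<diamondop> (\<pi>\<^sub>1 \<star>\<^sub>2 id2 (h \<star> k))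
      = (\<pi>\<^sub>1 \<star>\<^sub>2 id2 (j \<star> a)) \<diamondop> (id2 q \<star>\<^sub>2 (id2 c\<^sub>1 \<star>\<^sub>2 \<sigma>))"
    using whisker_exchange[of \<pi>\<^sub>1 \<sigma>] by (simp add: normalize)
  have nat': "(id2 q \<star>\<^sub>2 (id2 a \<star>\<^sub>2 L)) \<diamondop> (id2 q \<star>\<^sub>2 (s \<star>\<^sub>2 id2 k))
      = (id2 q \<star>\<^sub>2 (L' \<star>\<^sub>2 id2 a)) \<diamondop> (id2 q \<star>\<^sub>2 (id2 d\<^sub>1 \<star>\<^sub>2 \<sigma>))"
    using arg_cong[OF nat, of "\<lambda>z. id2 q \<star>\<^sub>2 z"] by (simp add: normalize)
  have pent: "(\<pi> \<star>\<^sub>2 id2 (g \<star> k)) \<diamondop> ((id2 q \<star>\<^sub>2 (s \<star>\<^sub>2 id2 k)) \<diamondop> (\<pi>\<^sub>1 \<star>\<^sub>2 id2 (h \<star> k))) =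
    (id2 p \<star>\<^sub>2 (\<pi>\<^sub>3 \<star>\<^sub>2 id2 k)) \<diamondop> ((\<pi> \<star>\<^sub>2 id2 (c\<^sub>2 \<star> k)) \<diamondop> (id2 q \<star>\<^sub>2 (\<pi>\<^sub>2 \<star>\<^sub>2 id2 k)))"
    using arg_cong[OF pentagon, of "\<lambda>z. z \<star>\<^sub>2 id2 k"] by (simp add: normalize)
  have "\<pi> \<diamondop> (id2 q \<star>\<^sub>2 ((id2 a \<star>\<^sub>2 R) \<diamondop> (\<pi>\<^sub>2 \<star>\<^sub>2 id2 k)))
      = (\<pi> \<diamondop> (id2 q \<star>\<^sub>2 (id2 a \<star>\<^sub>2 R))) \<diamondop> (id2 q \<star>\<^sub>2 (\<pi>\<^sub>2 \<star>\<^sub>2 id2 k))"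
    by (simp add: normalize)
  also have "\<dots> = (id2 p \<star>\<^sub>2 (id2 b \<star>\<^sub>2 L))
      \<diamondop> ((id2 p \<star>\<^sub>2 (\<pi>\<^sub>3 \<star>\<^sub>2 id2 k)) \<diamondop> ((\<pi> \<star>\<^sub>2 id2 (c\<^sub>2 \<star> k)) \<diamondop> (id2 q \<star>\<^sub>2 (\<pi>\<^sub>2 \<star>\<^sub>2 id2 k))))"
    unfolding slide_R tri by (simp add: normalize)
  also have "\<dots> = ((id2 p \<star>\<^sub>2 (id2 b \<star>\<^sub>2 L)) \<diamondop> (\<pi> \<star>\<^sub>2 id2 (g \<star> k)))
      \<diamondop> ((id2 q \<star>\<^sub>2 (s \<star>\<^sub>2 id2 k)) \<diamondop> (\<pi>\<^sub>1 \<star>\<^sub>2 id2 (h \<star> k)))"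
    unfolding pent[symmetric] by (simp add: normalize)
  also have "\<dots> = \<pi> \<diamondop> (((id2 q \<star>\<^sub>2 (id2 a \<star>\<^sub>2 L)) \<diamondop> (id2 q \<star>\<^sub>2 (s \<star>\<^sub>2 id2 k))) \<diamondop> (\<pi>\<^sub>1 \<star>\<^sub>2 id2 (h \<star> k)))"
    unfolding slide_L by (simp add: normalize)
  also have "\<dots> = \<pi> \<diamondop> ((id2 q \<star>\<^sub>2 (L' \<star>\<^sub>2 id2 a))
      \<diamondop> ((id2 q \<star>\<^sub>2 (id2 d\<^sub>1 \<star>\<^sub>2 \<sigma>)) \<diamondop> (\<pi>\<^sub>1 \<star>\<^sub>2 id2 (h \<star> k))))"
    unfolding nat' by (simp add: normalize)
  also have "\<dots> = \<pi> \<diamondop> (((id2 q \<star>\<^sub>2 (L' \<star>\<^sub>2 id2 a)) \<diamondop> (\<pi>\<^sub>1 \<star>\<^sub>2 id2 (j \<star> a)))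
      \<diamondop> (id2 q \<star>\<^sub>2 (id2 c\<^sub>1 \<star>\<^sub>2 \<sigma>)))"
    unfolding slide_\<sigma> by (simp add: normalize)
  also have "\<dots> = \<pi> \<diamondop> (id2 q \<star>\<^sub>2 ((R' \<star>\<^sub>2 id2 a) \<diamondop> (id2 c\<^sub>1 \<star>\<^sub>2 \<sigma>)))"
    unfolding tri' by (simp add: normalize)
  finally have eq: "\<pi> \<diamondop> (id2 q \<star>\<^sub>2 ((id2 a \<star>\<^sub>2 R) \<diamondop> (\<pi>\<^sub>2 \<star>\<^sub>2 id2 k)))
      = \<pi> \<diamondop> (id2 q \<star>\<^sub>2 ((R' \<star>\<^sub>2 id2 a) \<diamondop> (id2 c\<^sub>1 \<star>\<^sub>2 \<sigma>)))" .
  from invertible2_cancel_left[OF inv _ _ eq] show ?thesis by (simp add: normalize)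
qed

end


section \<open>Strict functors and interchange cells\<close>

lemma (in strict_functor_on) pres_inverse2:
  assumes "inverse2 C \<theta> \<phi>" "dom1\<^bsub>C\<^esub> (dom2\<^bsub>C\<^esub> \<theta>) \<in> S" "two_category C"
  shows "inverse2 D (F2 \<theta>) (F2 \<phi>)"
proof -
  interpret C: two_category C by fact
  have S: "dom1\<^bsub>C\<^esub> (dom2\<^bsub>C\<^esub> \<phi>) \<in> S"
    using assms(1,2) C.globular(1)[of \<theta>] unfolding inverse2_def by simp
  show ?thesis
    using assms(1,2) S C.globular(1)[of \<theta>] unfolding inverse2_def
    by (simp add: bd2 pres_vcomp[symmetric] pres_id2)
qed

lemma (in strict_functor_on) pres_pseudo_section:
  assumes "two_category.pseudo_section C f" "dom1\<^bsub>C\<^esub> f \<in> S" "cod1\<^bsub>C\<^esub> f \<in> S" "two_category C"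
      "two_category D"
  shows "two_category.pseudo_section D (F1 f)"
proof -
  interpret C: two_category C by fact
  interpret D: two_category D by fact
  obtain g u where gu: "dom1\<^bsub>C\<^esub> g = cod1\<^bsub>C\<^esub> f" "dom2\<^bsub>C\<^esub> u = id1\<^bsub>C\<^esub> (dom1\<^bsub>C\<^esub> f)"
      "cod2\<^bsub>C\<^esub> u = g \<star>\<^bsub>C\<^esub> f" "invertible2 C u"
    using assms(1) unfolding C.pseudo_section_def by blast
  have S: "dom1\<^bsub>C\<^esub> (dom2\<^bsub>C\<^esub> u) \<in> S" using gu(2) assms(2) by (simp add: C.id1_bd)
  have "invertible2 D (F2 u)"
    using gu(4) pres_inverse2[OF _ S assms(4)] unfolding invertible2_def by blast
  then show ?thesis
    unfolding D.pseudo_section_def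
    using gu(1-3) S assms(2,3)
    by (intro exI[of _ "F1 g"] exI[of _ "F2 u"]) (simp add: bd1 bd2 pres_id1 pres_comp1)
qed

context gray_category
begin

lemma rwhisk_bd [simp]:
  "src (dom1 \<alpha>) = tgt f \<Longrightarrow> dom1 (\<alpha> \<triangleleft> f) = dom1 \<alpha> \<cdot> f"
  "src (dom1 \<alpha>) = tgt f \<Longrightarrow> cod1 (\<alpha> \<triangleleft> f) = cod1 \<alpha> \<cdot> f"
  "src (dom1 (dom2 \<phi>)) = tgt f \<Longrightarrow> dom2 (\<phi> \<triangleleft>\<^sub>2 f) = dom2 \<phi> \<triangleleft> f"
  "src (dom1 (dom2 \<phi>)) = tgt f \<Longrightarrow> cod2 (\<phi> \<triangleleft>\<^sub>2 f) = cod2 \<phi> \<triangleleft> f"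
  using strict_functor_on.bd1[OF rwhisk_functor] strict_functor_on.bd2[OF rwhisk_functor] by simp_all

lemma lwhisk_bd [simp]:
  "src g = tgt (dom1 \<beta>) \<Longrightarrow> dom1 (g \<triangleright> \<beta>) = g \<cdot> dom1 \<beta>"
  "src g = tgt (dom1 \<beta>) \<Longrightarrow> cod1 (g \<triangleright> \<beta>) = g \<cdot> cod1 \<beta>"
  "src g = tgt (dom1 (dom2 \<psi>)) \<Longrightarrow> dom2 (g \<triangleright>\<^sub>2 \<psi>) = g \<triangleright> dom2 \<psi>"
  "src g = tgt (dom1 (dom2 \<psi>)) \<Longrightarrow> cod2 (g \<triangleright>\<^sub>2 \<psi>) = g \<triangleright> cod2 \<psi>"
  using strict_functor_on.bd1[OF lwhisk_functor] strict_functor_on.bd2[OF lwhisk_functor] by simp_all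

lemma rwhisk_pres [simp]:
  "src a = tgt f \<Longrightarrow> id1 a \<triangleleft> f = id1 (a \<cdot> f)"
  "src (dom1 \<alpha>) = tgt f \<Longrightarrow> dom1 \<beta> = cod1 \<alpha> \<Longrightarrow> (\<beta> \<star> \<alpha>) \<triangleleft> f = (\<beta> \<triangleleft> f) \<star> (\<alpha> \<triangleleft> f)"
  "src (dom1 \<alpha>) = tgt f \<Longrightarrow> id2 \<alpha> \<triangleleft>\<^sub>2 f = id2 (\<alpha> \<triangleleft> f)"
  "src (dom1 (dom2 \<phi>)) = tgt f \<Longrightarrow> dom2 \<psi> = cod2 \<phi> \<Longrightarrow> (\<psi> \<diamondop> \<phi>) \<triangleleft>\<^sub>2 f = (\<psi> \<triangleleft>\<^sub>2 f) \<diamondop> (\<phi> \<triangleleft>\<^sub>2 f)"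
  "src (dom1 (dom2 \<phi>)) = tgt f \<Longrightarrow> dom1 (dom2 \<psi>) = cod1 (dom2 \<phi>) \<Longrightarrow>
     (\<psi> \<star>\<^sub>2 \<phi>) \<triangleleft>\<^sub>2 f = (\<psi> \<triangleleft>\<^sub>2 f) \<star>\<^sub>2 (\<phi> \<triangleleft>\<^sub>2 f)"
  using strict_functor_on.pres_id1[OF rwhisk_functor] strict_functor_on.pres_comp1[OF rwhisk_functor]
    strict_functor_on.pres_id2[OF rwhisk_functor] strict_functor_on.pres_vcomp[OF rwhisk_functor]
    strict_functor_on.pres_hcomp[OF rwhisk_functor] by simp_all

lemma lwhisk_pres [simp]:
  "src g = tgt a \<Longrightarrow> g \<triangleright> id1 a = id1 (g \<cdot> a)"
  "src g = tgt (dom1 \<alpha>) \<Longrightarrow> dom1 \<beta> = cod1 \<alpha> \<Longrightarrow> g \<triangleright> (\<beta> \<star> \<alpha>) = (g \<triangleright> \<beta>) \<star> (g \<triangleright> \<alpha>)"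
  "src g = tgt (dom1 \<alpha>) \<Longrightarrow> g \<triangleright>\<^sub>2 id2 \<alpha> = id2 (g \<triangleright> \<alpha>)"
  "src g = tgt (dom1 (dom2 \<phi>)) \<Longrightarrow> dom2 \<psi> = cod2 \<phi> \<Longrightarrow> g \<triangleright>\<^sub>2 (\<psi> \<diamondop> \<phi>) = (g \<triangleright>\<^sub>2 \<psi>) \<diamondop> (g \<triangleright>\<^sub>2 \<phi>)"
  "src g = tgt (dom1 (dom2 \<phi>)) \<Longrightarrow> dom1 (dom2 \<psi>) = cod1 (dom2 \<phi>) \<Longrightarrow>
     g \<triangleright>\<^sub>2 (\<psi> \<star>\<^sub>2 \<phi>) = (g \<triangleright>\<^sub>2 \<psi>) \<star>\<^sub>2 (g \<triangleright>\<^sub>2 \<phi>)"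
  using strict_functor_on.pres_id1[OF lwhisk_functor] strict_functor_on.pres_comp1[OF lwhisk_functor]
    strict_functor_on.pres_id2[OF lwhisk_functor] strict_functor_on.pres_vcomp[OF lwhisk_functor]
    strict_functor_on.pres_hcomp[OF lwhisk_functor] by simp_all

lemma whisker_one [simp]:
  "src f = A \<Longrightarrow> f \<cdot> one A = f" "tgt f = A \<Longrightarrow> one A \<cdot> f = f"
  "src (dom1 \<alpha>) = A \<Longrightarrow> \<alpha> \<triangleleft> one A = \<alpha>" "tgt (dom1 \<alpha>) = A \<Longrightarrow> one A \<triangleright> \<alpha> = \<alpha>"
  "src (dom1 (dom2 \<phi>)) = A \<Longrightarrow> \<phi> \<triangleleft>\<^sub>2 one A = \<phi>" "tgt (dom1 (dom2 \<phi>)) = A \<Longrightarrow> one A \<triangleright>\<^sub>2 \<phi> = \<phi>"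
  using one0 one1 one2 by auto

declare bd [simp] src_tgt [simp] one_bd [simp] comp0_bd [simp] interch_bd [simp]
  assoc0 [simp] assoc1 [simp] assoc2 [simp]

lemma rwhisk_vinv:
  assumes "invertible2 K \<theta>" "src (dom1 (dom2 \<theta>)) = tgt f"
  shows "vinv K \<theta> \<triangleleft>\<^sub>2 f = vinv K (\<theta> \<triangleleft>\<^sub>2 f)"
  using strict_functor_on.pres_inverse2[OF rwhisk_functor vinv_inverse2[OF assms(1)] _
      two_category_axioms]
    assms(2) by (metis (mono_tags, lifting) mem_Collect_eq vinv_eqI)

lemma rwhisk_invertible2: "invertible2 K \<theta> \<Longrightarrow> src (dom1 (dom2 \<theta>)) = tgt f \<Longrightarrow> invertible2 K (\<theta> \<triangleleft>\<^sub>2 f)"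
  using strict_functor_on.pres_inverse2[OF rwhisk_functor _ _ two_category_axioms]
  unfolding invertible2_def by (metis (mono_tags, lifting) mem_Collect_eq)

lemma rwhisk_pseudo_section:
  "pseudo_section f \<Longrightarrow> src (dom1 f) = tgt h \<Longrightarrow> pseudo_section (f \<triangleleft> h)"
  using strict_functor_on.pres_pseudo_section[OF rwhisk_functor _ _ _
      two_category_axioms two_category_axioms] by simp

lemma lwhisk_pseudo_section:
  "pseudo_section f \<Longrightarrow> src h = tgt (dom1 f) \<Longrightarrow> pseudo_section (h \<triangleright> f)"
  using strict_functor_on.pres_pseudo_section[OF lwhisk_functor _ _ _
      two_category_axioms two_category_axioms] by simp

text \<open>Naturality of \<open>\<Sigma>\<langle>\<alpha>, -\<rangle>\<close> for \<open>\<alpha> : 1 \<rightarrow> h\<close> expresses \<open>\<alpha>\<close> composed with \<open>\<phi>\<close> by \<open>h \<phi>\<close> and interchange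
  cells that depend on the boundary of \<open>\<phi>\<close> only. So if \<open>\<alpha>\<close> can be cancelled, then \<open>\<phi>\<close> is determined
  by \<open>h \<phi>\<close> and its boundary.\<close>
lemma pseudo_section_lwhisk_faithful:
  assumes "pseudo_section \<alpha>" and par: "dom2 \<phi> = dom2 \<psi>" "cod2 \<phi> = cod2 \<psi>"
    and s: "src (dom1 \<alpha>) = tgt (dom1 (dom2 \<phi>))" and one: "dom1 \<alpha> = one (tgt (dom1 (dom2 \<phi>)))"
    and eq: "cod1 \<alpha> \<triangleright>\<^sub>2 \<phi> = cod1 \<alpha> \<triangleright>\<^sub>2 \<psi>"
  shows "\<phi> = \<psi>"
proof -
  let ?B = "cod1 (dom2 \<phi>)"
  have n: "dom1 \<alpha> \<triangleright>\<^sub>2 \<phi> = \<phi>" "dom1 \<alpha> \<triangleright>\<^sub>2 \<psi> = \<psi>" using one par by simp_all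
  have sp: "src (dom1 \<alpha>) = tgt (dom1 (dom2 \<psi>))" using s par by simp
  have "\<Sigma>\<langle>\<alpha>, cod2 \<phi>\<rangle> \<diamondop> (id2 (\<alpha> \<triangleleft> ?B) \<star>\<^sub>2 \<phi>) = \<Sigma>\<langle>\<alpha>, cod2 \<phi>\<rangle> \<diamondop> (id2 (\<alpha> \<triangleleft> ?B) \<star>\<^sub>2 \<psi>)"
    using interch_natural(2)[OF s] interch_natural(2)[OF sp] n par eq by simp
  then have "id2 (\<alpha> \<triangleleft> ?B) \<star>\<^sub>2 \<phi> = id2 (\<alpha> \<triangleleft> ?B) \<star>\<^sub>2 \<psi>"
    by (rule invertible2_cancel_left[OF interch_invertible[of \<alpha> "cod2 \<phi>"], rotated -1])
      (use s one par in simp_all)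
  then show ?thesis
    by (rule pseudo_section_cancel[OF rwhisk_pseudo_section[OF assms(1)], rotated -1])
      (use par s one in simp_all)
qed

text \<open>The same with naturality of \<open>\<Sigma>\<langle>-, \<beta>\<rangle>\<close> for \<open>\<beta> : 1 \<rightarrow> h\<close>.\<close>
lemma pseudo_section_rwhisk_faithful:
  assumes "pseudo_section \<beta>" and par: "dom2 \<phi> = dom2 \<psi>" "cod2 \<phi> = cod2 \<psi>"
    and s: "src (dom1 (dom2 \<phi>)) = tgt (dom1 \<beta>)" and one: "dom1 \<beta> = one (src (dom1 (dom2 \<phi>)))"
    and eq: "\<phi> \<triangleleft>\<^sub>2 cod1 \<beta> = \<psi> \<triangleleft>\<^sub>2 cod1 \<beta>"
  shows "\<phi> = \<psi>"
proof -
  let ?g = "cod1 (dom2 \<phi>)"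
  have n: "\<phi> \<triangleleft>\<^sub>2 dom1 \<beta> = \<phi>" "\<psi> \<triangleleft>\<^sub>2 dom1 \<beta> = \<psi>" using one par by simp_all
  have sp: "src (dom1 (dom2 \<psi>)) = tgt (dom1 \<beta>)" using s par by simp
  have "(id2 (?g \<triangleright> \<beta>) \<star>\<^sub>2 \<phi>) \<diamondop> \<Sigma>\<langle>dom2 \<phi>, \<beta>\<rangle> = (id2 (?g \<triangleright> \<beta>) \<star>\<^sub>2 \<psi>) \<diamondop> \<Sigma>\<langle>dom2 \<phi>, \<beta>\<rangle>"
    using interch_natural(1)[OF s] interch_natural(1)[OF sp] n par eq by simp
  then have "id2 (?g \<triangleright> \<beta>) \<star>\<^sub>2 \<phi> = id2 (?g \<triangleright> \<beta>) \<star>\<^sub>2 \<psi>"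
    by (rule invertible2_cancel_right[OF interch_invertible[of "dom2 \<phi>" \<beta>], rotated -1])
      (use s one par in simp_all)
  then show ?thesis
    by (rule pseudo_section_cancel[OF lwhisk_pseudo_section[OF assms(1)], rotated -1])
      (use par s one in simp_all)
qed

lemma lwhisk_inverse2:
  "inverse2 K \<theta> \<phi> \<Longrightarrow> src g = tgt (dom1 (dom2 \<theta>)) \<Longrightarrow> inverse2 K (g \<triangleright>\<^sub>2 \<theta>) (g \<triangleright>\<^sub>2 \<phi>)"
  using strict_functor_on.pres_inverse2[OF lwhisk_functor _ _ two_category_axioms] by auto

lemma comp0_tail:
  "g \<cdot> f = h \<cdot> k \<Longrightarrow> src g = tgt f \<Longrightarrow> src h = tgt k \<Longrightarrow> src f = tgt z \<Longrightarrow> src k = tgt z \<Longrightarrow>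
     g \<cdot> (f \<cdot> z) = h \<cdot> (k \<cdot> z)"
  by (metis assoc0)

lemma comp0_one_tail:
  "g \<cdot> f = one A \<Longrightarrow> src g = tgt f \<Longrightarrow> src f = tgt z \<Longrightarrow> tgt z = A \<Longrightarrow> g \<cdot> (f \<cdot> z) = z"
  by (metis assoc0 whisker_one(2))

declare interch_invertible [simp]

end


section \<open>Normal forms of whiskered cells under a Gray-monad\<close>

context gray_endofunctor
begin

interpretation T: strict_functor_on K UNIV K "T0 T" "T1 T" "T2 T" by (rule T_functor)

lemma T_pres [simp]:
  "dom1 (T1 T f) = T0 T (dom1 f)" "cod1 (T1 T f) = T0 T (cod1 f)"
  "T1 T (id1 a) = id1 (T0 T a)"
  "dom1 g = cod1 f \<Longrightarrow> T1 T (g \<star> f) = T1 T g \<star> T1 T f"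
  "dom2 (T2 T \<theta>) = T1 T (dom2 \<theta>)" "cod2 (T2 T \<theta>) = T1 T (cod2 \<theta>)"
  "T2 T (id2 f) = id2 (T1 T f)"
  "dom2 \<psi> = cod2 \<phi> \<Longrightarrow> T2 T (\<psi> \<diamondop> \<phi>) = T2 T \<psi> \<diamondop> T2 T \<phi>"
  "dom1 (dom2 \<psi>) = cod1 (dom2 \<phi>) \<Longrightarrow> T2 T (\<psi> \<star>\<^sub>2 \<phi>) = T2 T \<psi> \<star>\<^sub>2 T2 T \<phi>"
  using T.bd1 T.bd2 T.pres_id1 T.pres_comp1 T.pres_id2 T.pres_vcomp T.pres_hcomp by simp_all

declare T0_bd [simp] T_one [simp] T_comp0 [simp] T_whisk1 [simp] T_whisk2 [simp]

lemma T_inverse2: "inverse2 K \<theta> \<phi> \<Longrightarrow> inverse2 K (T2 T \<theta>) (T2 T \<phi>)"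
  using T.pres_inverse2[OF _ _ two_category_axioms] by auto

lemma T_pseudo_section: "pseudo_section f \<Longrightarrow> pseudo_section (T1 T f)"
  using T.pres_pseudo_section two_category_axioms by auto

end

context gray_monad
begin

declare mu_bd [simp] eta_bd [simp]

text \<open>Oriented as follows, naturality moves \<open>\<mu>\<close> and \<open>\<eta>\<close> to the right of everything that they are
  natural in, where the monad laws apply to them. This yields a normal form of
  the whiskered cells in the axioms and their restrictions, so that the simplifier identifies equal
  ones. The laws are also needed followed by a further 0-cell \<open>z\<close>, as composites are bracketed to the
  right. The variable \<open>B\<close> stands for \<open>tgt f\<close> because the simplifier evaluates targets.\<close>

lemma mu0 [simp]:
  "tgt f = B \<Longrightarrow> mu T B \<cdot> T0 T (T0 T f) = T0 T f \<cdot> mu T (src f)"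
  "tgt f = B \<Longrightarrow> T0 T (mu T B) \<cdot> T0 T (T0 T (T0 T f)) = T0 T (T0 T f) \<cdot> T0 T (mu T (src f))"
  using mu_natural(1)[of f] by (auto simp: T_comp0[symmetric] simp del: T_comp0)

lemma mu0_tail [simp]:
  "tgt f = B \<Longrightarrow> To T (To T (src f)) = tgt z \<Longrightarrow> mu T B \<cdot> (T0 T (T0 T f) \<cdot> z) = T0 T f \<cdot> (mu T (src f) \<cdot> z)"
  "tgt f = B \<Longrightarrow> To T (To T (To T (src f))) = tgt z \<Longrightarrow>
     T0 T (mu T B) \<cdot> (T0 T (T0 T (T0 T f)) \<cdot> z) = T0 T (T0 T f) \<cdot> (T0 T (mu T (src f)) \<cdot> z)"
  using comp0_tail[OF mu0(1)] comp0_tail[OF mu0(2)] by simp_all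

lemma eta0 [simp]:
  "tgt f = B \<Longrightarrow> eta T B \<cdot> f = T0 T f \<cdot> eta T (src f)"
  "tgt f = B \<Longrightarrow> T0 T (eta T B) \<cdot> T0 T f = T0 T (T0 T f) \<cdot> T0 T (eta T (src f))"
  "tgt f = B \<Longrightarrow> T0 T (T0 T (eta T B)) \<cdot> T0 T (T0 T f)
      = T0 T (T0 T (T0 T f)) \<cdot> T0 T (T0 T (eta T (src f)))"
  using eta_natural(1)[of f] by (auto simp: T_comp0[symmetric] simp del: T_comp0)

lemma eta0_tail [simp]:
  "tgt f = B \<Longrightarrow> To T (src f) = tgt z \<Longrightarrow>
     T0 T (eta T B) \<cdot> (T0 T f \<cdot> z) = T0 T (T0 T f) \<cdot> (T0 T (eta T (src f)) \<cdot> z)"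
  "tgt f = B \<Longrightarrow> To T (To T (src f)) = tgt z \<Longrightarrow> T0 T (T0 T (eta T B)) \<cdot> (T0 T (T0 T f) \<cdot> z) =
     T0 T (T0 T (T0 T f)) \<cdot> (T0 T (T0 T (eta T (src f))) \<cdot> z)"
  using comp0_tail[OF eta0(2)] comp0_tail[OF eta0(3)] by simp_all

lemma mu_mu [simp]:
  "mu T A \<cdot> T0 T (mu T A) = mu T A \<cdot> mu T (To T A)"
  "T0 T (mu T A) \<cdot> T0 T (T0 T (mu T A)) = T0 T (mu T A) \<cdot> T0 T (mu T (To T A))"
  using mu_assoc[of A] by (simp_all add: T_comp0[symmetric] del: T_comp0)

lemma mu_mu_tail [simp]:
  "tgt z = To T (To T (To T A)) \<Longrightarrow> mu T A \<cdot> (T0 T (mu T A) \<cdot> z) = mu T A \<cdot> (mu T (To T A) \<cdot> z)"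
  "tgt z = To T (To T (To T (To T A))) \<Longrightarrow>
    T0 T (mu T A) \<cdot> (T0 T (T0 T (mu T A)) \<cdot> z) = T0 T (mu T A) \<cdot> (T0 T (mu T (To T A)) \<cdot> z)"
  using comp0_tail[OF mu_mu(1)] comp0_tail[OF mu_mu(2)] by simp_all

lemma unit [simp]:
  "mu T A \<cdot> eta T (To T A) = one (To T A)"
  "mu T A \<cdot> T0 T (eta T A) = one (To T A)"
  "T0 T (mu T A) \<cdot> T0 T (eta T (To T A)) = one (To T (To T A))"
  "T0 T (mu T A) \<cdot> T0 T (T0 T (eta T A)) = one (To T (To T A))"
  "T0 T (T0 T (mu T A)) \<cdot> T0 T (T0 T (eta T (To T A))) = one (To T (To T (To T A)))"
  using mu_eta[of A] mu_T_eta[of A] by (simp_all add: T_comp0[symmetric] del: T_comp0)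

lemma unit_tail [simp]:
  "tgt z = To T A \<Longrightarrow> mu T A \<cdot> (eta T (To T A) \<cdot> z) = z"
  "tgt z = To T A \<Longrightarrow> mu T A \<cdot> (T0 T (eta T A) \<cdot> z) = z"
  "tgt z = To T (To T A) \<Longrightarrow> T0 T (mu T A) \<cdot> (T0 T (eta T (To T A)) \<cdot> z) = z"
  "tgt z = To T (To T A) \<Longrightarrow> T0 T (mu T A) \<cdot> (T0 T (T0 T (eta T A)) \<cdot> z) = z"
  "tgt z = To T (To T (To T A)) \<Longrightarrow> T0 T (T0 T (mu T A)) \<cdot> (T0 T (T0 T (eta T (To T A))) \<cdot> z) = z"
  using comp0_one_tail[OF unit(1)] comp0_one_tail[OF unit(2)] comp0_one_tail[OF unit(3)]
    comp0_one_tail[OF unit(4)] comp0_one_tail[OF unit(5)] by simp_all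

lemma nat1 [simp]:
  "tgt (dom1 \<alpha>) = B \<Longrightarrow> mu T B \<triangleright> T1 T (T1 T \<alpha>) = T1 T \<alpha> \<triangleleft> mu T (src (dom1 \<alpha>))"
  "tgt (dom1 \<alpha>) = B \<Longrightarrow> eta T B \<triangleright> \<alpha> = T1 T \<alpha> \<triangleleft> eta T (src (dom1 \<alpha>))"
  "tgt (dom1 \<alpha>) = B \<Longrightarrow> T0 T (eta T B) \<triangleright> T1 T \<alpha> = T1 T (T1 T \<alpha>) \<triangleleft> T0 T (eta T (src (dom1 \<alpha>)))"
  using mu_natural(2)[of \<alpha>] eta_natural(2)[of \<alpha>]
  by (auto simp: T_whisk1[symmetric] simp del: T_whisk1)

lemma nat1_tail [simp]:
  "tgt (dom1 \<alpha>) = B \<Longrightarrow> tgt z = To T (To T (src (dom1 \<alpha>))) \<Longrightarrow> mu T B \<triangleright> (T1 T (T1 T \<alpha>) \<triangleleft> z)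
      = T1 T \<alpha> \<triangleleft> (mu T (src (dom1 \<alpha>)) \<cdot> z)"
  "tgt (dom1 \<alpha>) = B \<Longrightarrow> tgt z = To T (src (dom1 \<alpha>)) \<Longrightarrow> T0 T (eta T B) \<triangleright> (T1 T \<alpha> \<triangleleft> z)
      = T1 T (T1 T \<alpha>) \<triangleleft> (T0 T (eta T (src (dom1 \<alpha>))) \<cdot> z)"
  by (simp_all add: assoc1(2)[symmetric] del: assoc1(2))

lemma nat2 [simp]:
  "tgt (dom1 (dom2 \<phi>)) = B \<Longrightarrow> mu T B \<triangleright>\<^sub>2 T2 T (T2 T \<phi>) = T2 T \<phi> \<triangleleft>\<^sub>2 mu T (src (dom1 (dom2 \<phi>)))"
  using mu_natural(3) by auto

text \<open>By naturality of \<open>\<eta>\<close>, the operation \<open>x T(-)\<close> restricted along \<open>\<eta>\<close> is \<open>(x \<eta>) (-)\<close>.\<close>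
lemma lwhisk_T2_faithful:
  assumes "pseudo_section \<alpha>" "dom1 \<alpha> = one X" "cod1 \<alpha> = x \<cdot> eta T X" "src x = To T X"
    and par: "dom2 \<phi> = dom2 \<psi>" "cod2 \<phi> = cod2 \<psi>" and X: "tgt (dom1 (dom2 \<phi>)) = X"
    and eq: "x \<triangleright>\<^sub>2 T2 T \<phi> = x \<triangleright>\<^sub>2 T2 T \<psi>"
  shows "\<phi> = \<psi>"
proof (rule pseudo_section_lwhisk_faithful[OF assms(1) par])
  have "(x \<cdot> eta T X) \<triangleright>\<^sub>2 \<chi> = (x \<triangleright>\<^sub>2 T2 T \<chi>) \<triangleleft>\<^sub>2 eta T (src (dom1 (dom2 \<phi>)))"
    if "dom2 \<chi> = dom2 \<phi>" for \<chi>
    using that assms(4) X eta_natural(3)[of \<chi>] by simp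
  then show "cod1 \<alpha> \<triangleright>\<^sub>2 \<phi> = cod1 \<alpha> \<triangleright>\<^sub>2 \<psi>"
    using eq par assms(3) by metis
qed (use assms in simp_all)

end


section \<open>The redundant axioms\<close>

context pseudo_algebra_data
begin

declare x_bd [simp] m_bd [simp] i_bd [simp] \<pi>_bd [simp] lam_bd [simp] \<rho>_bd [simp]
  \<pi>_invertible [simp] comp1_assoc [simp] comp1_id_cond [simp] hcomp_assoc [simp] hcomp_id2 [simp]

lemma pseudo_section_m: "pseudo_section m" and pseudo_section_i: "pseudo_section i"
  using m_adjoint_equivalence i_adjoint_equivalence
  unfolding adjoint_equivalence_def pseudo_section_def by blast+

lemma LAA3_redundant:
  assumes LAA1: "LAA1 K T X x m \<pi>" and LAA4: "LAA4 K T X x m i \<pi> lam \<rho>"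
  shows "LAA3 K T X x m i \<pi> lam"
proof -
  let ?Tx = "T0 T x" and ?TTx = "T0 T (T0 T x)" and ?T\<mu> = "T0 T (mu T X)"
    and ?T\<eta> = "T0 T (eta T X)" and ?T\<eta>T = "T0 T (eta T (To T X))"
  (* The cells of (LAA1) restricted along T \<eta> at T\<^sup>2 X, those of (LAA4) restricted along T\<^sup>2 x and along
     T \<mu>, and the 1-cells between which they run. *)
  let ?a = "m \<triangleleft> ?TTx" and ?b = "x \<triangleright> T1 T m" and ?q = "m \<triangleleft> mu T (To T X)" and ?p = "m \<triangleleft> ?T\<mu>"
    and ?c = "m \<triangleleft> (?T\<eta> \<cdot> ?Tx \<cdot> ?TTx)" and ?d = "x \<triangleright> (T1 T m \<triangleleft> (?T\<eta>T \<cdot> ?TTx))"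
    and ?j = "x \<triangleright> (T1 T i \<triangleleft> (?Tx \<cdot> ?TTx))"
    and ?c' = "m \<triangleleft> (?T\<eta> \<cdot> ?Tx \<cdot> ?T\<mu>)" and ?d' = "x \<triangleright> (T1 T m \<triangleleft> (?T\<eta>T \<cdot> ?T\<mu>))"
    and ?e = "(x \<cdot> ?Tx \<cdot> ?T\<eta>) \<triangleright> T1 T m" and ?j' = "x \<triangleright> (T1 T i \<triangleleft> (?Tx \<cdot> ?T\<mu>))"
    and ?\<pi>' = "\<pi> \<triangleleft>\<^sub>2 (?T\<eta>T \<cdot> ?TTx)" and ?\<pi>'' = "\<pi> \<triangleleft>\<^sub>2 (?T\<eta>T \<cdot> ?T\<mu>)"
    and ?s = "vinv K \<Sigma>\<langle>m \<triangleleft> ?T\<eta>, T1 T m\<rangle>" and ?t = "x \<triangleright>\<^sub>2 T2 T (\<pi> \<triangleleft>\<^sub>2 eta T (To T (To T X)))"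
    and ?\<sigma> = "x \<triangleright>\<^sub>2 T2 T (vinv K \<Sigma>\<langle>i, m\<rangle>)"
    and ?L = "x \<triangleright>\<^sub>2 (T2 T lam \<triangleleft>\<^sub>2 ?TTx)" and ?L' = "x \<triangleright>\<^sub>2 (T2 T lam \<triangleleft>\<^sub>2 ?T\<mu>)"
    and ?R = "\<rho> \<triangleleft>\<^sub>2 (?Tx \<cdot> ?TTx)" and ?R' = "\<rho> \<triangleleft>\<^sub>2 (?Tx \<cdot> ?T\<mu>)"
  have E1: "inverse2 K \<Sigma>\<langle>m \<triangleleft> ?T\<eta>, T1 T m\<rangle> ?s" by (rule vinv_inverse2) simp
  have E2: "inverse2 K (x \<triangleright>\<^sub>2 \<Sigma>\<langle>T1 T i, T1 T m\<rangle>) ?\<sigma>"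
    using lwhisk_inverse2[OF T_inverse2[OF vinv_inverse2[of "\<Sigma>\<langle>i, m\<rangle>"]], of x] by (simp add: T_interch)
  (* Naturality in \<rho>: the interchange cell at the domain of \<rho> splits along m T\<eta> and x Ti, and at the
     codomain 1 it is an identity. *)
  have nat0: "?R' \<star>\<^sub>2 id2 ?b = ((id2 ?b \<star>\<^sub>2 ?R) \<diamondop> (\<Sigma>\<langle>m \<triangleleft> ?T\<eta>, T1 T m\<rangle> \<star>\<^sub>2 id2 ?j))
    \<diamondop> (id2 ?c' \<star>\<^sub>2 (x \<triangleright>\<^sub>2 \<Sigma>\<langle>T1 T i, T1 T m\<rangle>))"
    using interch_natural(1)[of \<rho> "T1 T m"]
    by (simp add: interch_comp interch_id vcomp_id_cond assoc_interch vcomp_assoc)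
  have "id2 ?p \<star>\<^sub>2 (id2 ?b \<star>\<^sub>2 ?L) = id2 ?p \<star>\<^sub>2 ((?L' \<star>\<^sub>2 id2 ?b) \<diamondop> (id2 ?d' \<star>\<^sub>2 ?\<sigma>) \<diamondop> (?t \<star>\<^sub>2 id2 ?j))"
  proof (rule left_unit_pasting[where \<pi>=\<pi> and \<pi>'="?\<pi>'" and \<pi>''="?\<pi>''" and s="?s" and R="?R" and R'="?R'"
       and c="?c" and c'="?c'" and d="?d" and e="?e" and j'="?j'" and q="?q" and a="?a"])
    show "(?\<pi>'' \<star>\<^sub>2 id2 ?e) \<diamondop> (id2 ?p \<star>\<^sub>2 ?s) \<diamondop> (\<pi> \<star>\<^sub>2 id2 ?c)
        = (id2 ?p \<star>\<^sub>2 ?t) \<diamondop> (\<pi> \<star>\<^sub>2 id2 ?d) \<diamondop> (id2 ?q \<star>\<^sub>2 ?\<pi>')"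
      using arg_cong[OF iffD1[OF LAA1_def LAA1], of "\<lambda>z. z \<triangleleft>\<^sub>2 T0 T (eta T (To T (To T X)))"]
      by (simp add: rwhisk_vinv assoc_interch)
    show "(id2 ?a \<star>\<^sub>2 ?L) \<diamondop> (?\<pi>' \<star>\<^sub>2 id2 ?j) = id2 ?a \<star>\<^sub>2 ?R"
      using arg_cong[OF iffD1[OF LAA4_def LAA4], of "\<lambda>z. z \<triangleleft>\<^sub>2 ?TTx"]
      by simp
    show "(id2 ?p \<star>\<^sub>2 ?L') \<diamondop> (?\<pi>'' \<star>\<^sub>2 id2 ?j') = id2 ?p \<star>\<^sub>2 ?R'"
      using arg_cong[OF iffD1[OF LAA4_def LAA4], of "\<lambda>z. z \<triangleleft>\<^sub>2 ?T\<mu>"]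
      by simp
    show "id2 ?b \<star>\<^sub>2 ?R = (?R' \<star>\<^sub>2 id2 ?b) \<diamondop> (id2 ?c' \<star>\<^sub>2 ?\<sigma>) \<diamondop> (?s \<star>\<^sub>2 id2 ?j)"
    proof (rule transpose_right[OF inverse2_whisker_right[OF E1]])
      show "(?R' \<star>\<^sub>2 id2 ?b) \<diamondop> (id2 ?c' \<star>\<^sub>2 ?\<sigma>) = (id2 ?b \<star>\<^sub>2 ?R) \<diamondop> (\<Sigma>\<langle>m \<triangleleft> ?T\<eta>, T1 T m\<rangle> \<star>\<^sub>2 id2 ?j)"
        by (rule transpose_right[OF inverse2_whisker_left[OF E2] nat0, symmetric]) simp_all
    qed simp_all
  qed (simp_all add: rwhisk_invertible2)
  then have "id2 ?b \<star>\<^sub>2 ?L = (?L' \<star>\<^sub>2 id2 ?b) \<diamondop> (id2 ?d' \<star>\<^sub>2 ?\<sigma>) \<diamondop> (?t \<star>\<^sub>2 id2 ?j)"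
    by (rule pseudo_section_cancel[OF rwhisk_pseudo_section[OF pseudo_section_m], rotated -1]) simp_all
  then have A: "x \<triangleright>\<^sub>2 T2 T (id2 m \<star>\<^sub>2 (lam \<triangleleft>\<^sub>2 ?Tx)) = x \<triangleright>\<^sub>2 T2 T (((lam \<triangleleft>\<^sub>2 mu T X) \<star>\<^sub>2 id2 m)
     \<diamondop> (id2 (m \<triangleleft> eta T (To T X) \<triangleleft> mu T X) \<star>\<^sub>2 vinv K \<Sigma>\<langle>i, m\<rangle>)
     \<diamondop> ((\<pi> \<triangleleft>\<^sub>2 eta T (To T (To T X))) \<star>\<^sub>2 id2 (i \<triangleleft> x \<triangleleft> T0 T x)))"
    by simp
  show ?thesis unfolding LAA3_def
    by (rule lwhisk_T2_faithful[OF pseudo_section_i _ _ _ _ _ _ A]) simp_all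
qed

lemma LAA2_redundant:
  assumes LAA1: "LAA1 K T X x m \<pi>" and LAA4: "LAA4 K T X x m i \<pi> lam \<rho>"
  shows "LAA2 K T X x m i \<pi> \<rho>"
proof -
  let ?Tx = "T0 T x" and ?TTx = "T0 T (T0 T x)" and ?T\<mu> = "T0 T (mu T X)"
    and ?\<mu>T = "mu T (To T X)"
    and ?T\<eta> = "T0 T (eta T X)" and ?TT\<eta> = "T0 T (T0 T (eta T X))" and ?T\<eta>T = "T0 T (eta T (To T X))"
    and ?TT\<eta>T = "T0 T (T0 T (eta T (To T X)))"
  (* The cells of (LAA1) restricted along T\<^sup>2 \<eta> at TX, those of (LAA4) under x T(-) and restricted along
     \<mu> at TX, and the 1-cells between which they run. *)
  let ?a = "m \<triangleleft> ?TTx" and ?b = "x \<triangleright> T1 T m" and ?q = "m \<triangleleft> ?\<mu>T" and ?p = "m \<triangleleft> ?T\<mu>"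
    and ?c\<^sub>1 = "m \<triangleleft> (?T\<eta> \<cdot> ?Tx \<cdot> ?\<mu>T)" and ?d\<^sub>1 = "x \<triangleright> (T1 T m \<triangleleft> (?T\<eta>T \<cdot> ?\<mu>T))"
    and ?h = "m \<triangleleft> (?TTx \<cdot> T0 T ?TTx \<cdot> ?TT\<eta>T)"
    and ?g = "x \<triangleright> ?Tx \<triangleright> (T1 T (T1 T m) \<triangleleft> ?TT\<eta>T)"
    and ?c\<^sub>2 = "x \<triangleright> (T1 T m \<triangleleft> (?TT\<eta> \<cdot> ?TTx))"
    and ?k = "x \<triangleright> ?Tx \<triangleright> (T1 T (T1 T i) \<triangleleft> ?TTx)" and ?j = "x \<triangleright> (T1 T i \<triangleleft> (?Tx \<cdot> ?\<mu>T))"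
    and ?\<pi>\<^sub>1 = "\<pi> \<triangleleft>\<^sub>2 (?T\<eta>T \<cdot> ?\<mu>T)" and ?\<pi>\<^sub>2 = "\<pi> \<triangleleft>\<^sub>2 (?TT\<eta> \<cdot> ?TTx)"
    and ?\<pi>\<^sub>3 = "x \<triangleright>\<^sub>2 T2 T (\<pi> \<triangleleft>\<^sub>2 ?T\<eta>T)"
    and ?\<Sigma> = "\<Sigma>\<langle>m, T1 T (T1 T m) \<triangleleft> ?TT\<eta>T\<rangle>" and ?s = "vinv K \<Sigma>\<langle>m, T1 T (T1 T m) \<triangleleft> ?TT\<eta>T\<rangle>"
    and ?\<sigma> = "\<Sigma>\<langle>m, T1 T (T1 T i) \<triangleleft> ?TTx\<rangle>"
    and ?L = "x \<triangleright>\<^sub>2 ?Tx \<triangleright>\<^sub>2 T2 T (T2 T lam)" and ?L' = "x \<triangleright>\<^sub>2 (T2 T lam \<triangleleft>\<^sub>2 ?\<mu>T)"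
    and ?R = "x \<triangleright>\<^sub>2 (T2 T \<rho> \<triangleleft>\<^sub>2 ?TTx)" and ?R' = "\<rho> \<triangleleft>\<^sub>2 (?Tx \<cdot> ?\<mu>T)"
  have E: "inverse2 K ?\<Sigma> ?s" by (rule vinv_inverse2) simp
  (* Naturality in T\<^sup>2 \<lambda>: the interchange cell at the domain splits along T\<^sup>2(m \<eta>) and T\<^sup>2(i x). *)
  have nat0: "id2 ?a \<star>\<^sub>2 ?L = ((?L' \<star>\<^sub>2 id2 ?a) \<diamondop> (id2 ?d\<^sub>1 \<star>\<^sub>2 ?\<sigma>)) \<diamondop> (?\<Sigma> \<star>\<^sub>2 id2 ?k)"
    using interch_natural(2)[of m "T2 T (T2 T lam)"]
    by (simp add: interch_comp interch_id vcomp_id_cond assoc_interch vcomp_assoc)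
  have "id2 ?q \<star>\<^sub>2 ((?R' \<star>\<^sub>2 id2 ?a) \<diamondop> (id2 ?c\<^sub>1 \<star>\<^sub>2 ?\<sigma>))
      = id2 ?q \<star>\<^sub>2 ((id2 ?a \<star>\<^sub>2 ?R) \<diamondop> (?\<pi>\<^sub>2 \<star>\<^sub>2 id2 ?k))"
  proof (rule right_unit_pasting[where \<pi>=\<pi> and \<pi>\<^sub>1="?\<pi>\<^sub>1" and \<pi>\<^sub>3="?\<pi>\<^sub>3" and s="?s" and L="?L"
       and L'="?L'" and d\<^sub>1="?d\<^sub>1" and h="?h" and g="?g" and c\<^sub>2="?c\<^sub>2" and j="?j" and b="?b" and p="?p"])
    show "(\<pi> \<star>\<^sub>2 id2 ?g) \<diamondop> (id2 ?q \<star>\<^sub>2 ?s) \<diamondop> (?\<pi>\<^sub>1 \<star>\<^sub>2 id2 ?h)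
        = (id2 ?p \<star>\<^sub>2 ?\<pi>\<^sub>3) \<diamondop> (\<pi> \<star>\<^sub>2 id2 ?c\<^sub>2) \<diamondop> (id2 ?q \<star>\<^sub>2 ?\<pi>\<^sub>2)"
      using arg_cong[OF iffD1[OF LAA1_def LAA1], of "\<lambda>z. z \<triangleleft>\<^sub>2 T0 T (T0 T (eta T (To T X)))"]
      by (simp add: rwhisk_vinv assoc_interch)
    show "(id2 ?b \<star>\<^sub>2 ?L) \<diamondop> (?\<pi>\<^sub>3 \<star>\<^sub>2 id2 ?k) = id2 ?b \<star>\<^sub>2 ?R"
      using arg_cong[OF iffD1[OF LAA4_def LAA4], of "\<lambda>z. x \<triangleright>\<^sub>2 T2 T z"]
      by simp
    show "(id2 ?q \<star>\<^sub>2 ?L') \<diamondop> (?\<pi>\<^sub>1 \<star>\<^sub>2 id2 ?j) = id2 ?q \<star>\<^sub>2 ?R'"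
      using arg_cong[OF iffD1[OF LAA4_def LAA4], of "\<lambda>z. z \<triangleleft>\<^sub>2 ?\<mu>T"]
      by simp
    show "(id2 ?a \<star>\<^sub>2 ?L) \<diamondop> (?s \<star>\<^sub>2 id2 ?k) = (?L' \<star>\<^sub>2 id2 ?a) \<diamondop> (id2 ?d\<^sub>1 \<star>\<^sub>2 ?\<sigma>)"
      by (rule transpose_right[OF inverse2_whisker_right[OF E] nat0, symmetric]) simp_all
  qed simp_all
  then have "(?R' \<star>\<^sub>2 id2 ?a) \<diamondop> (id2 ?c\<^sub>1 \<star>\<^sub>2 ?\<sigma>) = (id2 ?a \<star>\<^sub>2 ?R) \<diamondop> (?\<pi>\<^sub>2 \<star>\<^sub>2 id2 ?k)"
    by (rule pseudo_section_cancel[OF rwhisk_pseudo_section[OF pseudo_section_m], rotated -1]) simp_all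
  then have A: "(((\<rho> \<triangleleft>\<^sub>2 mu T X) \<star>\<^sub>2 id2 m)
     \<diamondop> (id2 (m \<triangleleft> mu T (To T X) \<triangleleft> T0 T (T0 T (eta T X))) \<star>\<^sub>2 \<Sigma>\<langle>m, T1 T (T1 T i)\<rangle>)) \<triangleleft>\<^sub>2 ?TTx
     = ((id2 m \<star>\<^sub>2 (x \<triangleright>\<^sub>2 T2 T \<rho>))
     \<diamondop> ((\<pi> \<triangleleft>\<^sub>2 T0 T (T0 T (eta T X))) \<star>\<^sub>2 id2 ((x \<cdot> T0 T x) \<triangleright> T1 T (T1 T i)))) \<triangleleft>\<^sub>2 ?TTx"
    by (simp add: assoc_interch)
  show ?thesis unfolding LAA2_def
    by (rule pseudo_section_rwhisk_faithful[OF T_pseudo_section,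
          OF T_pseudo_section, OF pseudo_section_i])
      (use arg_cong[OF A, of "\<lambda>z. z \<triangleleft>\<^sub>2 T0 T (T0 T (eta T X))"] in simp_all)
qed

end


theorem proposition3:
  fixes K :: "('o, 'a, 'b, 'c) gray_cat"
    and T :: "('o, 'a, 'b, 'c) gray_mnd"
    and X :: 'o and x :: 'a
    and m m' i i' :: 'b
    and u\<^sub>m e\<^sub>m u\<^sub>i e\<^sub>i \<pi> lam \<rho> :: 'c
  assumes "gray_category K"
    and "gray_monad K T"
    and "pseudo_algebra_data K T X x m m' u\<^sub>m e\<^sub>m i i' u\<^sub>i e\<^sub>i \<pi> lam \<rho>"
    and "LAA1 K T X x m \<pi>"
    and "LAA4 K T X x m i \<pi> lam \<rho>"
  shows "LAA2 K T X x m i \<pi> \<rho> \<and> LAA3 K T X x m i \<pi> lam"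
proof -
  interpret pseudo_algebra_data K T X x m m' u\<^sub>m e\<^sub>m i i' u\<^sub>i e\<^sub>i \<pi> lam \<rho>
    by fact
  show ?thesis
    using LAA2_redundant LAA3_redundant assms(4,5) by blast
qed

end
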